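(* Let $\mathfrak{L}$ be a split regular BiHom-Leibniz superalgebra with respect to $H$, with root system $\Lambda$. Then $$\mathfrak{L}=U+\sum_{[\alpha]\in \Lambda/\sim}I_{[\alpha]},$$ where $U$ is a linear complement in $H$ of $\mathrm{span}_{\mathbb{K}}\{[\mathfrak{L}_{\alpha\psi^{-1}}, \mathfrak{L}_{-\alpha\phi^{-1}}] :\alpha\in \Lambda \}$, each $I_{[\alpha]}=I_{H,[\alpha]}\oplus V_{[\alpha]}$ is an ideal of $\mathfrak{L}$, and $[I_{[\alpha]},I_{[\beta]}]=0$ whenever $[\alpha]\neq[\beta]$.
   Context: A BiHom-Leibniz superalgebra is a $\mathbb{Z}_2$-graded vector space $\mathfrak{L}=\mathfrak{L}_{\bar 0}\oplus\mathfrak{L}_{\bar 1}$ (of arbitrary dimension, over an arbitrary base field $\mathbb{K}$) with a bilinear product $[\cdot,\cdot]:\mathfrak{L}\times\mathfrak{L}\to\mathfrak{L}$ and two superspace homomorphisms (even linear maps) $\phi,\psi:\mathfrak{L}\to\mathfrak{L}$ such that, for all $x\in\mathfrak{L}_{\bar i}$, $y\in\mathfrak{L}_{\bar j}$, $z\in\mathfrak{L}_{\bar k}$: $[x,y]\in\mathfrak{L}_{\bar i+\bar j}$, $\phi\circ\psi=\psi\circ\phi$, and $$[\phi\psi(x),[y,z]]=[[\psi(x),y],\psi(z)]+(-1)^{\bar i\bar j}[\psi(y),[\phi(x),z]].$$ It is regular if $\phi,\psi$ are algebra automorphisms. A subalgebra $A$ is a graded subspace with $[A,A]\subset A$, $\phi(A)=A$,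 $\psi(A)=A$. An ideal $I$ is a graded subspace with $[I,\mathfrak{L}]+[\mathfrak{L},I]\subset I$, $\phi(I)=I$, $\psi(I)=I$. For subspaces $A,B$, $[A,B]$ is the linear span of the products $[a,b]$, $a\in A$, $b\in B$. Let $H=H_{\bar 0}\oplus H_{\bar 1}$ be a maximal abelian subalgebra of a regular BiHom-Leibniz superalgebra $\mathfrak{L}$. For a linear functional $\alpha:H_{\bar 0}\to\mathbb{K}$, put $\mathfrak{L}_\alpha:=\{v\in\mathfrak{L}:[h,\phi(v)]=\alpha(h)\,\phi\psi(v)\text{ for all }h\in H_{\bar 0}\}$. Let $\Lambda:=\{\alpha\in (H_{\bar 0})^*\setminus\{0\}:\mathfrak{L}_\alpha\neq 0\}$ (the root system; its elements are the nonzero roots). $\mathfrak{L}$ is split with respect to $H$ if $\mathfrak{L}=H\oplus\bigoplus_{\alpha\in\Lambda}\mathfrak{L}_\alpha$. The restrictions of $\phi^{\pm1},\psi^{\pm1}$ to $H$ are denoted by the same letters, and $\alpha\phi^{z_1}\psi^{z_2}$ denotes the composition $\alpha\circ\phi^{z_1}\circ\psi^{z_2}$ on $H_{\bar 0}$ ($z_1,z_2\in\mathbb{Z}$). Put $-\Lambda=\{-\alpha:\alpha\in\Lambda\}$, $\pm\Lambda=\Lambda\cup(-\Lambda)$. $\mathbb{N}$ is the set of nonnegative integers. Connection of roots: for $\alpha,\beta\in\Lambda$, $\alpha$ is connected to $\beta$ ($\alpha\sim\beta$) if either $\beta=\epsilon\alpha\phi^{z_1}\psi^{z_2}$ for some $z_1,z_2\in\mathbb{Z}$,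 $\epsilon\in\{-1,1\}$, or there exists $\{\alpha_1,\dots,\alpha_k\}\subset\pm\Lambda$, $k\ge 2$, such that (1) $\alpha_1\in\{\alpha\phi^{-n}\psi^{-r}:n,r\in\mathbb{N}\}$; (2) for every $1\le i\le k-2$, $\alpha_1\phi^{-i}+\alpha_2\phi^{-i+1}\psi^{-1}+\alpha_3\phi^{-i+2}\psi^{-1}+\cdots+\alpha_i\phi^{-1}\psi^{-1}+\alpha_{i+1}\psi^{-1}\in\pm\Lambda$; (3) $\alpha_1\phi^{-k+1}+\alpha_2\phi^{-k+2}\psi^{-1}+\cdots+\alpha_i\phi^{-k+i}\psi^{-1}+\cdots+\alpha_{k-1}\phi^{-1}\psi^{-1}+\alpha_k\psi^{-1}\in\{\pm\beta\phi^{-m}\psi^{-s}:m,s\in\mathbb{N}\}$. The relation $\sim$ is an equivalence relation on $\Lambda$; $[\alpha]$ denotes the class of $\alpha$ and $\Lambda/\sim$ the quotient set. For $[\alpha]\in\Lambda/\sim$ put $I_{H,[\alpha]}:=\mathrm{span}_{\mathbb{K}}\{[\mathfrak{L}_{\beta\psi^{-1}},\mathfrak{L}_{-\beta\phi^{-1}}]:\beta\in[\alpha]\}\subset H$, $V_{[\alpha]}:=\bigoplus_{\beta\in[\alpha]}\mathfrak{L}_\beta$, and $I_{[\alpha]}:=I_{H,[\alpha]}\oplus V_{[\alpha]}$. *)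

theory Defs
  imports Complex_Main "HOL-Library.Z2" "HOL-Library.Function_Algebras" "HOL-Library.Set_Algebras"
begin

text \<open>
  The underlying vector space is the whole type \<open>'v\<close>, over an arbitrary field \<open>'k\<close>.
  Degrees live in the two-element field \<open>bit\<close>, whose addition is addition modulo 2.
  Sums of two subspaces are Minkowski sums \<open>A + B\<close> (theory Set-Algebras), and sums
  of arbitrary families are spans of unions. Functions are added
  (theory Function-Algebras) and negated pointwise; note that \<open>-\<close> applied to a set is the complement,
  so the set of negated elements is always written as an image under \<open>uminus\<close>.
\<close>

record ('k, 'v) bihom_superalg =
  scl :: "'k \<Rightarrow> 'v \<Rightarrow> 'v"
  part :: "bit \<Rightarrow> 'v set"
  brk :: "'v \<Rightarrow> 'v \<Rightarrow> 'v"
  phi :: "'v \<Rightarrow> 'v"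
  psi :: "'v \<Rightarrow> 'v"

abbreviation lspan :: "('k::field, 'v::ab_group_add) bihom_superalg \<Rightarrow> 'v set \<Rightarrow> 'v set" where
  "lspan L \<equiv> module.span (scl L)"

abbreviation lsubspace :: "('k::field, 'v::ab_group_add) bihom_superalg \<Rightarrow> 'v set \<Rightarrow> bool" where
  "lsubspace L \<equiv> module.subspace (scl L)"

definition is_direct_sum2 :: "'v::ab_group_add set \<Rightarrow> 'v set \<Rightarrow> 'v set \<Rightarrow> bool" where
  "is_direct_sum2 S A B \<longleftrightarrow> S = A + B \<and> A \<inter> B = {0}"

definition is_direct_sum ::
    "('k::field, 'v::ab_group_add) bihom_superalg \<Rightarrow> 'v set \<Rightarrow> ('i \<Rightarrow> 'v set) \<Rightarrow> 'i set \<Rightarrow> bool" where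
  "is_direct_sum L S W I \<longleftrightarrow>
     S = lspan L (\<Union>i\<in>I. W i) \<and>
     (\<forall>i\<in>I. W i \<inter> lspan L (\<Union>j\<in>I - {i}. W j) = {0})"

definition koszul_sign :: "bit \<Rightarrow> bit \<Rightarrow> 'k::field" where
  "koszul_sign i j = (if i * j = 1 then - 1 else 1)"

locale bihom_leibniz_superalgebra = vector_space "scl L"
  for L :: "('k::field, 'v::ab_group_add) bihom_superalg" +
  assumes part_subspace: "subspace (part L i)"
    and part_direct: "is_direct_sum2 UNIV (part L 0) (part L 1)"
    and brk_linear_right: "Vector_Spaces.linear (scl L) (scl L) (\<lambda>y. brk L x y)"
    and brk_linear_left: "Vector_Spaces.linear (scl L) (scl L) (\<lambda>x. brk L x y)"
    and phi_linear: "Vector_Spaces.linear (scl L) (scl L) (phi L)"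
    and psi_linear: "Vector_Spaces.linear (scl L) (scl L) (psi L)"
    and phi_even: "phi L ` part L i \<subseteq> part L i"
    and psi_even: "psi L ` part L i \<subseteq> part L i"
    and brk_graded: "\<lbrakk>x \<in> part L i; y \<in> part L j\<rbrakk> \<Longrightarrow> brk L x y \<in> part L (i + j)"
    and phi_psi_commute: "phi L \<circ> psi L = psi L \<circ> phi L"
    and leibniz: "\<lbrakk>x \<in> part L i; y \<in> part L j; z \<in> part L k\<rbrakk> \<Longrightarrow>
      brk L (phi L (psi L x)) (brk L y z) =
        brk L (brk L (psi L x) y) (psi L z)
        + scl L (koszul_sign i j) (brk L (psi L y) (brk L (phi L x) z))"

locale regular_bihom_leibniz_superalgebra = bihom_leibniz_superalgebra L
  for L :: "('k::field, 'v::ab_group_add) bihom_superalg" +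
  assumes phi_bij: "bij (phi L)"
    and psi_bij: "bij (psi L)"
    and phi_brk: "phi L (brk L x y) = brk L (phi L x) (phi L y)"
    and psi_brk: "psi L (brk L x y) = brk L (psi L x) (psi L y)"

definition graded_subspace :: "('k::field, 'v::ab_group_add) bihom_superalg \<Rightarrow> 'v set \<Rightarrow> bool" where
  "graded_subspace L A \<longleftrightarrow>
     lsubspace L A \<and> is_direct_sum2 A (A \<inter> part L 0) (A \<inter> part L 1)"

definition brk_span :: "('k::field, 'v::ab_group_add) bihom_superalg \<Rightarrow> 'v set \<Rightarrow> 'v set \<Rightarrow> 'v set" where
  "brk_span L A B = lspan L {brk L a b | a b. a \<in> A \<and> b \<in> B}"

definition subalgebra :: "('k::field, 'v::ab_group_add) bihom_superalg \<Rightarrow> 'v set \<Rightarrow> bool" where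
  "subalgebra L A \<longleftrightarrow>
     graded_subspace L A \<and> brk_span L A A \<subseteq> A \<and> phi L ` A = A \<and> psi L ` A = A"

definition bihom_ideal :: "('k::field, 'v::ab_group_add) bihom_superalg \<Rightarrow> 'v set \<Rightarrow> bool" where
  "bihom_ideal L I \<longleftrightarrow>
     graded_subspace L I \<and> brk_span L I UNIV + brk_span L UNIV I \<subseteq> I \<and>
     phi L ` I = I \<and> psi L ` I = I"

definition abelian_subalgebra :: "('k::field, 'v::ab_group_add) bihom_superalg \<Rightarrow> 'v set \<Rightarrow> bool" where
  "abelian_subalgebra L A \<longleftrightarrow> subalgebra L A \<and> brk_span L A A = {0}"

definition maximal_abelian_subalgebra ::
    "('k::field, 'v::ab_group_add) bihom_superalg \<Rightarrow> 'v set \<Rightarrow> bool" where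
  "maximal_abelian_subalgebra L H \<longleftrightarrow>
     abelian_subalgebra L H \<and> (\<forall>A. abelian_subalgebra L A \<and> H \<subseteq> A \<longrightarrow> A = H)"

abbreviation even_part :: "('k::field, 'v::ab_group_add) bihom_superalg \<Rightarrow> 'v set \<Rightarrow> 'v set" where
  "even_part L H \<equiv> H \<inter> part L 0"

text \<open>
  The dual space of the even part of \<open>H\<close>: a linear functional on \<open>even_part L H\<close> is
  represented by the function on \<open>'v\<close> that is 0 outside \<open>even_part L H\<close>. Hence
  functionals are equal iff they are equal as HOL functions.
\<close>

definition dual_even ::
    "('k::field, 'v::ab_group_add) bihom_superalg \<Rightarrow> 'v set \<Rightarrow> ('v \<Rightarrow> 'k) set" where
  "dual_even L H = {\<alpha>.
     (\<forall>x\<in>even_part L H. \<forall>y\<in>even_part L H. \<alpha> (x + y) = \<alpha> x + \<alpha> y) \<and>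
     (\<forall>c. \<forall>x\<in>even_part L H. \<alpha> (scl L c x) = c * \<alpha> x) \<and>
     (\<forall>x. x \<notin> even_part L H \<longrightarrow> \<alpha> x = 0)}"

definition root_space ::
    "('k::field, 'v::ab_group_add) bihom_superalg \<Rightarrow> 'v set \<Rightarrow> ('v \<Rightarrow> 'k) \<Rightarrow> 'v set" where
  "root_space L H \<alpha> =
     {v. \<forall>h\<in>even_part L H. brk L h (phi L v) = scl L (\<alpha> h) (phi L (psi L v))}"

definition roots ::
    "('k::field, 'v::ab_group_add) bihom_superalg \<Rightarrow> 'v set \<Rightarrow> ('v \<Rightarrow> 'k) set" where
  "roots L H = {\<alpha> \<in> dual_even L H - {0}. root_space L H \<alpha> \<noteq> {0}}"

definition pm_roots ::
    "('k::field, 'v::ab_group_add) bihom_superalg \<Rightarrow> 'v set \<Rightarrow> ('v \<Rightarrow> 'k) set" where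
  "pm_roots L H = roots L H \<union> uminus ` roots L H"

definition root_sum ::
    "('k::field, 'v::ab_group_add) bihom_superalg \<Rightarrow> 'v set \<Rightarrow> ('v \<Rightarrow> 'k) set \<Rightarrow> 'v set" where
  "root_sum L H C = lspan L (\<Union>\<beta>\<in>C. root_space L H \<beta>)"

locale split_regular_bihom_leibniz_superalgebra = regular_bihom_leibniz_superalgebra L
  for L :: "('k::field, 'v::ab_group_add) bihom_superalg" and H :: "'v set" +
  assumes H_maximal_abelian: "maximal_abelian_subalgebra L H"
    and H_roots_direct: "is_direct_sum2 UNIV H (root_sum L H (roots L H))"
    and roots_direct:
      "is_direct_sum L (root_sum L H (roots L H)) (root_space L H) (roots L H)"

definition int_iter :: "('v \<Rightarrow> 'v) \<Rightarrow> int \<Rightarrow> 'v \<Rightarrow> 'v" where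
  "int_iter f z = (if z \<ge> 0 then f ^^ nat z else inv f ^^ nat (- z))"

text \<open>
  The functional \<open>\<alpha> \<phi>\<^sup>z \<psi>\<^sup>w\<close>. The maps are not restricted to \<open>even_part L H\<close>: in the
  regular case they permute it and its complement, so the result again vanishes outside it.
\<close>

definition twist ::
    "('k::field, 'v::ab_group_add) bihom_superalg \<Rightarrow> ('v \<Rightarrow> 'k) \<Rightarrow> int \<Rightarrow> int \<Rightarrow> ('v \<Rightarrow> 'k)" where
  "twist L \<alpha> z w = \<alpha> \<circ> int_iter (phi L) z \<circ> int_iter (psi L) w"

text \<open>
  \<open>chain_sum L a i\<close> is
  \<open>a\<^sub>1 \<phi>\<^sup>-\<^sup>i + a\<^sub>2 \<phi>\<^sup>-\<^sup>i\<^sup>+\<^sup>1 \<psi>\<^sup>-\<^sup>1 + \<dots> + a\<^sub>i \<phi>\<^sup>-\<^sup>1 \<psi>\<^sup>-\<^sup>1 + a\<^sub>i\<^sub>+\<^sub>1 \<psi>\<^sup>-\<^sup>1\<close>;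
  the first summand carries no \<open>\<psi>\<^sup>-\<^sup>1\<close>.
\<close>

definition chain_sum ::
    "('k::field, 'v::ab_group_add) bihom_superalg \<Rightarrow> (nat \<Rightarrow> 'v \<Rightarrow> 'k) \<Rightarrow> nat \<Rightarrow> ('v \<Rightarrow> 'k)" where
  "chain_sum L a i =
     twist L (a 1) (- int i) 0 + (\<Sum>j = 2..i + 1. twist L (a j) (int j - 1 - int i) (- 1))"

definition root_chain ::
    "('k::field, 'v::ab_group_add) bihom_superalg \<Rightarrow> 'v set \<Rightarrow> ('v \<Rightarrow> 'k) \<Rightarrow> ('v \<Rightarrow> 'k) \<Rightarrow>
      nat \<Rightarrow> (nat \<Rightarrow> 'v \<Rightarrow> 'k) \<Rightarrow> bool" where
  "root_chain L H \<alpha> \<beta> k a \<longleftrightarrow>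
     k \<ge> 2 \<and> (\<forall>i\<in>{1..k}. a i \<in> pm_roots L H) \<and>
     a 1 \<in> {twist L \<alpha> (- int n) (- int r) | n r. True} \<and>
     (\<forall>i\<in>{1..k - 2}. chain_sum L a i \<in> pm_roots L H) \<and>
     chain_sum L a (k - 1) \<in>
       {twist L \<beta> (- int m) (- int s) | m s. True} \<union>
       {- twist L \<beta> (- int m) (- int s) | m s. True}"

definition connected_roots ::
    "('k::field, 'v::ab_group_add) bihom_superalg \<Rightarrow> 'v set \<Rightarrow> ('v \<Rightarrow> 'k) \<Rightarrow> ('v \<Rightarrow> 'k) \<Rightarrow> bool" where
  "connected_roots L H \<alpha> \<beta> \<longleftrightarrow>
     (\<exists>z w. \<beta> = twist L \<alpha> z w \<or> \<beta> = - twist L \<alpha> z w) \<or> (\<exists>k a. root_chain L H \<alpha> \<beta> k a)"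

definition connection ::
    "('k::field, 'v::ab_group_add) bihom_superalg \<Rightarrow> 'v set \<Rightarrow> (('v \<Rightarrow> 'k) \<times> ('v \<Rightarrow> 'k)) set" where
  "connection L H =
     {(\<alpha>, \<beta>). \<alpha> \<in> roots L H \<and> \<beta> \<in> roots L H \<and> connected_roots L H \<alpha> \<beta>}"

definition root_classes ::
    "('k::field, 'v::ab_group_add) bihom_superalg \<Rightarrow> 'v set \<Rightarrow> ('v \<Rightarrow> 'k) set set" where
  "root_classes L H = roots L H // connection L H"

text \<open>
  For a set \<open>C\<close> of roots, the span of all \<open>[L\<^bsub>\<beta>\<psi>\<^sup>-\<^sup>1\<^esub>, L\<^bsub>-\<beta>\<phi>\<^sup>-\<^sup>1\<^esub>]\<close> with \<open>\<beta> \<in> C\<close>.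
\<close>

definition cartan_span ::
    "('k::field, 'v::ab_group_add) bihom_superalg \<Rightarrow> 'v set \<Rightarrow> ('v \<Rightarrow> 'k) set \<Rightarrow> 'v set" where
  "cartan_span L H C =
     lspan L (\<Union>\<beta>\<in>C. brk_span L (root_space L H (twist L \<beta> 0 (- 1)))
                               (root_space L H (- twist L \<beta> (- 1) 0)))"

definition class_ideal ::
    "('k::field, 'v::ab_group_add) bihom_superalg \<Rightarrow> 'v set \<Rightarrow> ('v \<Rightarrow> 'k) set \<Rightarrow> 'v set" where
  "class_ideal L H C = cartan_span L H C + root_sum L H C"

definition linear_complement ::
    "('k::field, 'v::ab_group_add) bihom_superalg \<Rightarrow> 'v set \<Rightarrow> 'v set \<Rightarrow> 'v set \<Rightarrow> bool" where
  "linear_complement L H S U \<longleftrightarrow> lsubspace L U \<and> is_direct_sum2 H U S"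

end

theory Submission
  imports Defs
begin

text \<open>
  The even part of \<open>H\<close> acts by derivations up to twists, so \<open>[\<LL>\<^sub>\<alpha>, \<LL>\<^sub>\<beta>] \<subseteq> \<LL>\<^sub>\<gamma>\<close> with
  \<open>\<gamma> = \<alpha>\<phi>\<^sup>-\<^sup>1 + \<beta>\<psi>\<^sup>-\<^sup>1\<close>; moreover \<open>\<LL>\<^sub>0 = H\<close>. Consequently a nonzero product forces \<open>\<alpha> \<sim> \<beta>\<close>
  and \<open>\<gamma> = 0\<close> or \<open>\<gamma> \<sim> \<alpha>\<close>, and the Leibniz identity shows that the generators of \<open>I\<^bsub>H,[\<alpha>]\<^esub>\<close>
  annihilate the root spaces outside \<open>[\<alpha>]\<close>. Connection is an equivalence relation because the
  step \<open>s \<mapsto> s\<phi>\<^sup>-\<^sup>1 + a\<psi>\<^sup>-\<^sup>1\<close> underlying a chain is equivariant under twists and sign, and is undone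
  up to a twist by adding \<open>-a\<phi>\<^sup>-\<^sup>1\<close>.
\<close>

section \<open>Twists and graded subspaces\<close>

text \<open>The Leibniz identity is available for homogeneous arguments only, so it can be applied
  to root vectors only once the root spaces are known to be graded. It also demands arguments of the
  special forms phi psi(x) or psi(x); since both maps are invertible, every element has these forms,
  at the cost of a twist of its root. The product is not skew-symmetric, so [x, y] = 0 says nothing
  by itself about [y, x], and annihilation by the generators in H needs a different instance of the
  identity on each side. The root system need not be closed under negation. Weights such as -\<beta>
  phi^-1 may fail to be roots, which is why steps are taken in \<open>pm\<Lambda>\<close>; a member
  of \<open>pm\<Lambda>\<close> that is not a root has root space {0}, and the cases it creates are
  trivial. The twists in the generators of the part in H are those for which the weight of the
  product cancels: \<beta> psi^-1 phi^-1 - \<beta> phi^-1 psi^-1 = 0.\<close>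

lemma int_iter_0 [simp]: "int_iter f 0 = id"
  and int_iter_1 [simp]: "int_iter f 1 = f"
  and int_iter_minus1 [simp]: "int_iter f (-1) = inv f"
  by (simp_all add: int_iter_def fun_eq_iff)

text \<open>Both branches of \<open>int_iter\<close> obey one recursion, also across zero: for
  negative exponents one factor \<open>inv f\<close> cancels against \<open>f\<close>.\<close>

lemma int_iter_Suc:
  assumes "bij f"
  shows "int_iter f (a + 1) = int_iter f a \<circ> f"
proof (cases "a \<ge> 0")
  case True
  then have "nat (a + 1) = Suc (nat a)" by simp
  with True show ?thesis by (simp add: int_iter_def funpow_Suc_right del: funpow.simps)
next
  case False
  define m where "m = nat (- a - 1)"
  have a: "a = - int (Suc m)" using False by (simp add: m_def)
  have "int_iter f a \<circ> f = inv f ^^ m \<circ> (inv f \<circ> f)"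
    by (simp add: a int_iter_def funpow_Suc_right o_assoc nat_add_distrib del: funpow.simps)
  also have "\<dots> = inv f ^^ m" using assms by (simp add: bij_is_inj)
  also have "\<dots> = int_iter f (a + 1)" by (cases m) (simp_all add: a int_iter_def nat_add_distrib)
  finally show ?thesis ..
qed

lemma int_iter_add:
  assumes "bij f"
  shows "int_iter f (a + b) = int_iter f a \<circ> int_iter f b"
proof (induction b rule: int_induct[where k = 0])
  case base
  show ?case by simp
next
  case (step1 i)
  have "int_iter f (a + (i + 1)) = int_iter f (a + i) \<circ> f"
    using int_iter_Suc[OF assms, of "a + i"] by (simp add: add.assoc)
  then show ?case using step1 int_iter_Suc[OF assms, of i] by (simp add: o_assoc)
next
  case (step2 i)
  have ff: "f \<circ> inv f = id" using assms bij_is_surj surj_iff by blast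
  have *: "int_iter f (j - 1) = int_iter f j \<circ> inv f" for j
    using int_iter_Suc[OF assms, of "j - 1"] ff by (simp add: o_assoc[symmetric])
  have "int_iter f (a + (i - 1)) = int_iter f (a + i) \<circ> inv f"
    using *[of "a + i"] by (simp add: add_diff_eq)
  then show ?case using step2 *[of i] by (simp add: o_assoc)
qed

text \<open>The map \<open>g\<close> is kept arbitrary because it is instantiated by a structure
  map, by an integer power of one, and by a scalar multiplication.\<close>

lemma int_iter_commute:
  assumes "bij f" and fg: "f \<circ> g = g \<circ> f"
  shows "int_iter f a \<circ> g = g \<circ> int_iter f a"
proof (induction a rule: int_induct[where k = 0])
  case base
  show ?case by simp
next
  case (step1 i)
  have "int_iter f (i + 1) \<circ> g = (int_iter f i \<circ> g) \<circ> f"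
    by (simp only: int_iter_Suc[OF assms(1)] comp_assoc fg)
  then show ?case by (simp only: step1 int_iter_Suc[OF assms(1)] comp_assoc)
next
  case (step2 i)
  have "inv f (g x) = g (inv f x)" for x
    using assms by (metis bij_inv_eq_iff comp_apply)
  then have inv: "inv f \<circ> g = g \<circ> inv f" by (simp add: fun_eq_iff)
  have "int_iter f (i - 1) = int_iter f i \<circ> inv f"
    using int_iter_add[OF assms(1), of i "-1"] by simp
  then show ?case by (metis comp_assoc inv step2(2))
qed

text \<open>Equality of the image with \<open>S\<close>, rather than inclusion, lets membership pass
  through the inverse as well. With \<open>S\<close> the even part of H it shows that twisted
  functionals still vanish outside that part.\<close>

lemma int_iter_mem_iff:
  assumes "bij f" and "f ` S = S"
  shows "int_iter f a x \<in> S \<longleftrightarrow> x \<in> S"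
proof -
  have f: "f y \<in> S \<longleftrightarrow> y \<in> S" for y
    using assms by (metis bij_is_inj inj_image_mem_iff)
  have g: "inv f y \<in> S \<longleftrightarrow> y \<in> S" for y
    using f[of "inv f y"] assms(1) by (simp add: bij_is_surj surj_f_inv_f)
  have "(f ^^ n) x \<in> S \<longleftrightarrow> x \<in> S" and "(inv f ^^ n) x \<in> S \<longleftrightarrow> x \<in> S" for n
    by (induction n) (simp_all add: f g)
  then show ?thesis by (simp add: int_iter_def)
qed

lemma int_iter_additive:
  fixes f :: "'a::plus \<Rightarrow> 'a"
  assumes "bij f" "\<And>x y. f (x + y) = f x + f y"
  shows "int_iter f z (x + y) = int_iter f z x + int_iter f z y"
proof -
  have g: "inv f (x + y) = inv f x + inv f y" for x y
    using assms by (metis bij_inv_eq_iff)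
  have "(f ^^ n) (x + y) = (f ^^ n) x + (f ^^ n) y"
    and "(inv f ^^ n) (x + y) = (inv f ^^ n) x + (inv f ^^ n) y" for n
    by (induction n) (simp_all add: assms(2) g)
  then show ?thesis by (simp add: int_iter_def)
qed

lemma int_iter_scale:
  assumes "bij f" "\<And>c x. f (scl L c x) = scl L c (f x)"
  shows "int_iter f z (scl L c x) = scl L c (int_iter f z x)"
  using int_iter_commute[OF assms(1), of "scl L c" z] assms(2) by (simp add: fun_eq_iff)

lemma twist_plus: "twist L (\<alpha> + \<beta>) z w = twist L \<alpha> z w + twist L \<beta> z w"
  and twist_uminus: "twist L (- \<alpha>) z w = - twist L \<alpha> z w"
  and twist_zero [simp]: "twist L 0 z w = 0"
  and twist_id [simp]: "twist L \<alpha> 0 0 = \<alpha>"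
  by (simp_all add: twist_def fun_eq_iff)

lemma twist_sum: "twist L (\<Sum>j\<in>A. f j) z w = (\<Sum>j\<in>A. twist L (f j) z w)"
  by (induction A rule: infinite_finite_induct) (simp_all only: sum.infinite sum.empty sum.insert twist_plus twist_zero not_False_eq_True)

lemma is_direct_sum2_decomp:
  "is_direct_sum2 S A B \<Longrightarrow> x \<in> S \<Longrightarrow> \<exists>a\<in>A. \<exists>b\<in>B. x = a + b"
  unfolding is_direct_sum2_def by (blast elim: set_plus_elim)

context bihom_leibniz_superalgebra
begin

lemma brk_add_left: "brk L (x + y) z = brk L x z + brk L y z"
  and brk_scale_left: "brk L (scl L c x) z = scl L c (brk L x z)"
  using brk_linear_left[of z] by (simp_all add: Vector_Spaces.linear_iff)

lemma brk_add_right: "brk L x (y + z) = brk L x y + brk L x z"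
  and brk_scale_right: "brk L x (scl L c y) = scl L c (brk L x y)"
  using brk_linear_right[of x] by (simp_all add: Vector_Spaces.linear_iff)

lemma phi_add: "phi L (x + y) = phi L x + phi L y"
  and phi_scale: "phi L (scl L c x) = scl L c (phi L x)"
  using phi_linear by (simp_all add: Vector_Spaces.linear_iff)

lemma psi_add: "psi L (x + y) = psi L x + psi L y"
  and psi_scale: "psi L (scl L c x) = scl L c (psi L x)"
  using psi_linear by (simp_all add: Vector_Spaces.linear_iff)

lemma brk_zero_left [simp]: "brk L 0 z = 0"
  using brk_add_left[of 0 0 z] by simp

lemma brk_zero_right [simp]: "brk L z 0 = 0"
  using brk_add_right[of z 0 0] by simp

lemma phi_zero [simp]: "phi L 0 = 0"
  using phi_add[of 0 0] by simp

lemma psi_zero [simp]: "psi L 0 = 0"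
  using psi_add[of 0 0] by simp

lemma phi_psi: "phi L (psi L x) = psi L (phi L x)"
  using phi_psi_commute by (simp add: fun_eq_iff)

lemma phi_span: "phi L ` span S = span (phi L ` S)"
proof -
  interpret f: Vector_Spaces.linear "scl L" "scl L" "phi L" by (rule phi_linear)
  show ?thesis by (simp add: f.span_image)
qed

lemma psi_span: "psi L ` span S = span (psi L ` S)"
proof -
  interpret f: Vector_Spaces.linear "scl L" "scl L" "psi L" by (rule psi_linear)
  show ?thesis by (simp add: f.span_image)
qed

text \<open>Two span inductions, one for each argument. With \<open>S\<close> an ideal or {0},
  closure and annihilation statements are reduced to generators.\<close>

lemma brk_span_subset:
  assumes "subspace S" and "\<And>a b. a \<in> A \<Longrightarrow> b \<in> B \<Longrightarrow> brk L a b \<in> S"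
  shows "brk_span L (span A) (span B) \<subseteq> S"
proof -
  have *: "brk L a b \<in> S" if "a \<in> A" "b \<in> span B" for a b
    using that(2)
  proof (induction b rule: span_induct_alt)
    case base
    show ?case using assms(1) by (simp add: subspace_0)
  next
    case (step c x y)
    then show ?case using assms that(1)
      by (simp add: brk_add_right brk_scale_right subspace_add subspace_scale)
  qed
  have "brk L a b \<in> S" if "a \<in> span A" "b \<in> span B" for a b
    using that(1)
  proof (induction a rule: span_induct_alt)
    case base
    show ?case using assms(1) by (simp add: subspace_0)
  next
    case (step c x y)
    then show ?case using assms(1) *[OF _ that(2)]
      by (simp add: brk_add_left brk_scale_left subspace_add subspace_scale)
  qed
  then show ?thesis
    unfolding brk_span_def by (intro span_minimal) (auto simp: assms(1))
qed

section \<open>Homogeneous components and graded subspaces\<close>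

lemma part_inter: "part L 0 \<inter> part L 1 = {0}"
  using part_direct by (simp add: is_direct_sum2_def)

lemma part_decomp: "\<exists>x0\<in>part L 0. \<exists>x1\<in>part L 1. x = x0 + x1"
  using is_direct_sum2_decomp[OF part_direct] by simp

lemma part_unique:
  assumes "x0 \<in> part L 0" "x1 \<in> part L 1" "y0 \<in> part L 0" "y1 \<in> part L 1" "x0 + x1 = y0 + y1"
  shows "x0 = y0" and "x1 = y1"
proof -
  have "x0 - y0 = y1 - x1" using assms(5) by (simp add: algebra_simps)
  then have "x0 - y0 \<in> part L 0 \<inter> part L 1"
    using assms part_subspace subspace_diff by (metis IntI)
  then show "x0 = y0" using part_inter by simp
  with assms(5) show "x1 = y1" by simp
qed

lemma graded_subspaceI:
  assumes "subspace A" "\<And>x. x \<in> A \<Longrightarrow> \<exists>x0\<in>A \<inter> part L 0. \<exists>x1\<in>A \<inter> part L 1. x = x0 + x1"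
  shows "graded_subspace L A"
  unfolding graded_subspace_def is_direct_sum2_def
proof (intro conjI)
  show "A = A \<inter> part L 0 + A \<inter> part L 1"
  proof
    show "A \<subseteq> A \<inter> part L 0 + A \<inter> part L 1"
      using assms(2) by (blast intro: set_plus_intro)
    show "A \<inter> part L 0 + A \<inter> part L 1 \<subseteq> A"
      using assms(1) by (auto elim!: set_plus_elim simp: subspace_add)
  qed
  show "A \<inter> part L 0 \<inter> (A \<inter> part L 1) = {0}"
    using part_inter assms(1) subspace_0 by blast
qed fact

lemma graded_subspace_decomp:
  assumes "graded_subspace L A" "x \<in> A"
  shows "\<exists>x0\<in>A \<inter> part L 0. \<exists>x1\<in>A \<inter> part L 1. x = x0 + x1"
  using is_direct_sum2_decomp assms unfolding graded_subspace_def by blast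

text \<open>Additive statements need only be checked on homogeneous elements, the only ones covered
  by \<open>leibniz\<close>.\<close>

lemma graded_subspace_induct [consumes 2, case_names homogeneous add]:
  assumes "graded_subspace L A" "x \<in> A"
    and "\<And>i x. x \<in> A \<Longrightarrow> x \<in> part L i \<Longrightarrow> P x"
    and "\<And>x y. P x \<Longrightarrow> P y \<Longrightarrow> P (x + y)"
  shows "P x"
  using graded_subspace_decomp[OF assms(1,2)] assms(3,4) by blast

text \<open>The generators need not be homogeneous; it is enough that their components stay inside
  the span.\<close>

lemma graded_subspace_span:
  assumes "\<And>x. x \<in> S \<Longrightarrow> \<exists>x0\<in>span S \<inter> part L 0. \<exists>x1\<in>span S \<inter> part L 1. x = x0 + x1"
  shows "graded_subspace L (span S)"
proof (rule graded_subspaceI)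
  fix x assume "x \<in> span S"
  then show "\<exists>x0\<in>span S \<inter> part L 0. \<exists>x1\<in>span S \<inter> part L 1. x = x0 + x1"
  proof (induction x rule: span_induct_alt)
    case base
    show ?case using part_subspace
      by (intro bexI[of _ 0]) (simp_all add: subspace_0 span_zero)
  next
    case (step c x y)
    obtain x0 x1 where x: "x0 \<in> span S \<inter> part L 0" "x1 \<in> span S \<inter> part L 1" "x = x0 + x1"
      using assms[OF step(1)] by blast
    obtain y0 y1 where y: "y0 \<in> span S \<inter> part L 0" "y1 \<in> span S \<inter> part L 1" "y = y0 + y1"
      using step(2) by blast
    have "scl L c x + y = (scl L c x0 + y0) + (scl L c x1 + y1)"
      by (simp add: x y scale_right_distrib add_ac)
    moreover have "scl L c x0 + y0 \<in> span S \<inter> part L 0" "scl L c x1 + y1 \<in> span S \<inter> part L 1"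
      using x y part_subspace by (simp_all add: subspace_add subspace_scale span_add span_scale)
    ultimately show ?case by blast
  qed
qed simp

lemma graded_subspace_brk_span:
  assumes "graded_subspace L A" "graded_subspace L B"
  shows "graded_subspace L (brk_span L A B)"
  unfolding brk_span_def
proof (rule graded_subspace_span, clarify)
  fix a b assume ab: "a \<in> A" "b \<in> B"
  obtain a0 a1 where a: "a0 \<in> A \<inter> part L 0" "a1 \<in> A \<inter> part L 1" "a = a0 + a1"
    using graded_subspace_decomp[OF assms(1) ab(1)] by blast
  obtain b0 b1 where b: "b0 \<in> B \<inter> part L 0" "b1 \<in> B \<inter> part L 1" "b = b0 + b1"
    using graded_subspace_decomp[OF assms(2) ab(2)] by blast
  let ?S = "{brk L a b |a b. a \<in> A \<and> b \<in> B}"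
  have mem: "brk L u v \<in> span ?S" if "u \<in> A" "v \<in> B" for u v
    using that by (intro span_base) blast
  \<comment> \<open>Degrees add in \<open>bit\<close>, so the product of two odd components is
    even.\<close>
  have deg: "brk L a0 b0 \<in> part L 0" "brk L a1 b1 \<in> part L 0"
    "brk L a0 b1 \<in> part L 1" "brk L a1 b0 \<in> part L 1"
    using a b brk_graded[of a0 0 b0 0] brk_graded[of a1 1 b1 1]
      brk_graded[of a0 0 b1 1] brk_graded[of a1 1 b0 0] by simp_all
  have "brk L a b = (brk L a0 b0 + brk L a1 b1) + (brk L a0 b1 + brk L a1 b0)"
    by (simp add: a b brk_add_left brk_add_right add_ac)
  moreover have "brk L a0 b0 + brk L a1 b1 \<in> span ?S \<inter> part L 0"
    "brk L a0 b1 + brk L a1 b0 \<in> span ?S \<inter> part L 1"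
    using mem a b deg by (simp_all add: span_add subspace_add[OF part_subspace])
  ultimately show "\<exists>x0\<in>span ?S \<inter> part L 0. \<exists>x1\<in>span ?S \<inter> part L 1. brk L a b = x0 + x1"
    by blast
qed

lemma graded_subspace_span_Union:
  assumes "\<And>i. i \<in> I \<Longrightarrow> graded_subspace L (W i)"
  shows "graded_subspace L (span (\<Union>i\<in>I. W i))"
proof (rule graded_subspace_span)
  fix x assume "x \<in> (\<Union>i\<in>I. W i)"
  then obtain i where i: "i \<in> I" "x \<in> W i" by blast
  have "W i \<subseteq> span (\<Union>i\<in>I. W i)" using i(1) span_superset by blast
  then show "\<exists>x0\<in>span (\<Union>i\<in>I. W i) \<inter> part L 0. \<exists>x1\<in>span (\<Union>i\<in>I. W i) \<inter> part L 1. x = x0 + x1"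
    using graded_subspace_decomp[OF assms[OF i(1)] i(2)] by blast
qed

lemma graded_subspace_plus:
  assumes "graded_subspace L A" "graded_subspace L B"
  shows "graded_subspace L (A + B)"
proof -
  have sub: "subspace A" "subspace B" using assms by (simp_all add: graded_subspace_def)
  have "A + B = span (\<Union>i\<in>{A,B}. i)"
    using sub by (simp add: span_Un span_eq_iff[THEN iffD2] set_plus_def) blast
  then show ?thesis using graded_subspace_span_Union[of "{A,B}" id] assms by auto
qed

end

section \<open>Root spaces\<close>

context bihom_leibniz_superalgebra
begin

text \<open>The family \<open>v\<close> takes values in \<open>W i\<close> for every index, not only
  on \<open>F\<close>, so that eigenvalue equations apply to it without side conditions.\<close>

lemma span_Union_finite_sum:
  assumes "\<And>i. subspace (W i)" "x \<in> span (\<Union>i\<in>I. W i)"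
  shows "\<exists>F v. finite F \<and> F \<subseteq> I \<and> (\<forall>i. v i \<in> W i) \<and> x = (\<Sum>i\<in>F. v i)"
  using assms(2)
proof (induction x rule: span_induct_alt)
  case base
  show ?case using assms(1) subspace_0
    by (intro exI[of _ "{}"] exI[of _ "\<lambda>_. 0"]) simp
next
  case (step c x y)
  obtain i where i: "i \<in> I" "x \<in> W i" using step(1) by blast
  obtain F v where F: "finite F" "F \<subseteq> I" "\<forall>i. v i \<in> W i" "y = (\<Sum>i\<in>F. v i)"
    using step(2) by blast
  \<comment> \<open>The new index \<open>i\<close> may already belong to \<open>F\<close>, in which
    case both contributions are added; elsewhere the default is 0.\<close>
  define w where "w j = (if j = i then scl L c x else 0) + (if j \<in> F then v j else 0)" for j
  have "(\<Sum>j\<in>insert i F. if j \<in> F then v j else 0) = (\<Sum>j\<in>F. v j)"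
    using F(1) by (intro sum.mono_neutral_cong_right) auto
  then have "scl L c x + y = (\<Sum>j\<in>insert i F. w j)"
    using F(1) by (simp add: w_def sum.distrib F(4) del: sum.insert)
  moreover have "\<forall>j. w j \<in> W j"
    using F(3) i assms(1) by (auto simp: w_def intro!: subspace_add subspace_scale subspace_0)
  ultimately show ?case using F(1,2) i(1) by (intro exI[of _ "insert i F"] exI[of _ w]) auto
qed

end

context regular_bihom_leibniz_superalgebra
begin

section \<open>Invertible structure maps and the action of twists\<close>

lemma phi_inv [simp]: "phi L (inv (phi L) x) = x" "inv (phi L) (phi L x) = x"
  using phi_bij by (simp_all add: bij_is_surj surj_f_inv_f bij_is_inj inv_f_f)

lemma psi_inv [simp]: "psi L (inv (psi L) x) = x" "inv (psi L) (psi L x) = x"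
  using psi_bij by (simp_all add: bij_is_surj surj_f_inv_f bij_is_inj inv_f_f)

lemma phi_eq_iff [simp]: "phi L x = phi L y \<longleftrightarrow> x = y"
  using phi_bij by (simp add: bij_is_inj inj_eq)

lemma psi_eq_iff [simp]: "psi L x = psi L y \<longleftrightarrow> x = y"
  using psi_bij by (simp add: bij_is_inj inj_eq)

text \<open>Commutation of phi and psi lifts first to powers of phi, then to powers of psi. Twisting
  is therefore an action of Z x Z, and every twist can be undone.\<close>

lemma twist_twist [simp]: "twist L (twist L \<alpha> z w) z' w' = twist L \<alpha> (z + z') (w + w')"
proof -
  have "psi L \<circ> int_iter (phi L) z' = int_iter (phi L) z' \<circ> psi L"
    using int_iter_commute[OF phi_bij phi_psi_commute] by simp
  from int_iter_commute[OF psi_bij this]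
  have "int_iter (psi L) w (int_iter (phi L) z' x) = int_iter (phi L) z' (int_iter (psi L) w x)" for x
    by (simp add: fun_eq_iff)
  then show ?thesis
    by (simp add: twist_def int_iter_add[OF phi_bij] int_iter_add[OF psi_bij] fun_eq_iff)
qed

lemma twist_eq_iff [simp]: "twist L \<alpha> z w = twist L \<beta> z w \<longleftrightarrow> \<alpha> = \<beta>"
proof
  assume "twist L \<alpha> z w = twist L \<beta> z w"
  then have "twist L (twist L \<alpha> z w) (- z) (- w) = twist L (twist L \<beta> z w) (- z) (- w)" by simp
  then show "\<alpha> = \<beta>" unfolding twist_twist by simp
qed simp

lemma twist_eq_0_iff [simp]: "twist L \<alpha> z w = 0 \<longleftrightarrow> \<alpha> = 0"
  using twist_eq_iff[of \<alpha> z w 0] by (simp del: twist_eq_iff)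

text \<open>Evenness gives one inclusion only. For homogeneous x the components of its preimage map
  to the components of x, so by uniqueness one of them already maps to x.\<close>

lemma phi_part: "phi L ` part L i = part L i"
  and psi_part: "psi L ` part L i = part L i"
proof -
  have *: "f ` part L i = part L i"
    if f: "bij f" "\<And>x y. f (x + y) = f x + f y" "\<And>j. f ` part L j \<subseteq> part L j" for f
  proof
    show "part L i \<subseteq> f ` part L i"
    proof
      fix x assume x: "x \<in> part L i"
      obtain y where y: "x = f y" using f(1) by (metis bij_pointE)
      obtain y0 y1 where y01: "y0 \<in> part L 0" "y1 \<in> part L 1" "y = y0 + y1"
        using part_decomp by blast
      have m: "f y0 \<in> part L 0" "f y1 \<in> part L 1" using f(3) y01 by blast+
      have z: "(0::'v) \<in> part L j" for j using part_subspace subspace_0 by blast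
      have eq: "f y0 + f y1 = x" by (simp only: y y01(3) f(2))
      show "x \<in> f ` part L i"
      proof (cases i)
        case zero
        then have "f y0 = x"
          by (intro part_unique(1)[OF m _ z]) (use x eq in simp_all)
        then show ?thesis using zero y01 by blast
      next
        case one
        then have "f y1 = x"
          by (intro part_unique(2)[OF m z]) (use x eq in simp_all)
        then show ?thesis using one y01 by blast
      qed
    qed
  qed (rule f(3))
  show "phi L ` part L i = part L i" by (rule *[OF phi_bij phi_add phi_even])
  show "psi L ` part L i = part L i" by (rule *[OF psi_bij psi_add psi_even])
qed

end

context split_regular_bihom_leibniz_superalgebra
begin

section \<open>The even part of H, functionals on it, and their root spaces\<close>

lemma H_abelian: "abelian_subalgebra L H"
  using H_maximal_abelian by (simp add: maximal_abelian_subalgebra_def)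

lemma phi_H: "phi L ` H = H" and psi_H: "psi L ` H = H" and H_graded: "graded_subspace L H"
  using H_abelian by (simp_all add: abelian_subalgebra_def subalgebra_def)

lemma H_subspace: "subspace H"
  using H_graded by (simp add: graded_subspace_def)

lemma brk_H_H: assumes "x \<in> H" "y \<in> H" shows "brk L x y = 0"
proof -
  have "brk L x y \<in> brk_span L H H"
    unfolding brk_span_def using assms by (intro span_base) blast
  then show ?thesis using H_abelian by (simp add: abelian_subalgebra_def)
qed

lemma phi_even_H: "phi L ` even_part L H = even_part L H"
  and psi_even_H: "psi L ` even_part L H = even_part L H"
  using phi_bij psi_bij
  by (simp_all add: image_Int bij_is_inj phi_H psi_H phi_part psi_part)

lemma even_H_iff [simp]:
  "int_iter (phi L) z x \<in> even_part L H \<longleftrightarrow> x \<in> even_part L H"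
  "int_iter (psi L) z x \<in> even_part L H \<longleftrightarrow> x \<in> even_part L H"
  by (rule int_iter_mem_iff[OF phi_bij phi_even_H] int_iter_mem_iff[OF psi_bij psi_even_H])+

lemmas even_H_step [simp] =
  even_H_iff(1)[of 1, simplified int_iter_1] even_H_iff(1)[of "-1", simplified int_iter_minus1]
  even_H_iff(2)[of 1, simplified int_iter_1] even_H_iff(2)[of "-1", simplified int_iter_minus1]

abbreviation "\<Lambda> \<equiv> roots L H"
abbreviation "pm\<Lambda> \<equiv> pm_roots L H"
abbreviation "dual \<equiv> dual_even L H"
abbreviation "\<RR> \<equiv> root_space L H"

lemma dual_twist [intro, simp]:
  assumes "\<alpha> \<in> dual" shows "twist L \<alpha> z w \<in> dual"
  using assms unfolding dual_even_def twist_def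
  by (simp del: Int_iff add: int_iter_additive[OF phi_bij phi_add] int_iter_additive[OF psi_bij psi_add]
      int_iter_scale[OF phi_bij phi_scale] int_iter_scale[OF psi_bij psi_scale])

lemma dual_add [intro, simp]: "\<alpha> \<in> dual \<Longrightarrow> \<beta> \<in> dual \<Longrightarrow> \<alpha> + \<beta> \<in> dual"
  by (simp add: dual_even_def algebra_simps)

lemma dual_uminus [intro, simp]: "\<alpha> \<in> dual \<Longrightarrow> - \<alpha> \<in> dual"
  by (simp add: dual_even_def)

lemma roots_dual: "\<alpha> \<in> \<Lambda> \<Longrightarrow> \<alpha> \<in> dual" and roots_nonzero: "\<alpha> \<in> \<Lambda> \<Longrightarrow> \<alpha> \<noteq> 0"
  by (simp_all add: roots_def)

lemma root_spaceD: "v \<in> \<RR> \<alpha> \<Longrightarrow> h \<in> even_part L H \<Longrightarrow>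
    brk L h (phi L v) = scl L (\<alpha> h) (phi L (psi L v))"
  unfolding root_space_def by blast

lemma root_space_subspace: "subspace (\<RR> \<alpha>)"
  unfolding subspace_def root_space_def
  by (simp add: phi_add psi_add brk_add_right scale_right_distrib phi_scale psi_scale
      brk_scale_right scale_left_commute)

text \<open>For even h both sides of the eigenvalue equation preserve degrees, so uniqueness of
  components yields the equation for each component.\<close>

lemma root_space_graded: "graded_subspace L (\<RR> \<alpha>)"
proof (rule graded_subspaceI[OF root_space_subspace])
  fix x assume x: "x \<in> \<RR> \<alpha>"
  obtain x0 x1 where x01: "x0 \<in> part L 0" "x1 \<in> part L 1" "x = x0 + x1"
    using part_decomp by blast
  have "brk L h (phi L x0) = scl L (\<alpha> h) (phi L (psi L x0)) \<and>
      brk L h (phi L x1) = scl L (\<alpha> h) (phi L (psi L x1))" if h: "h \<in> even_part L H" for h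
  proof -
    have p: "phi L x0 \<in> part L 0" "phi L x1 \<in> part L 1"
      "phi L (psi L x0) \<in> part L 0" "phi L (psi L x1) \<in> part L 1"
      using x01 phi_even psi_even by blast+
    have "brk L h (phi L x0) \<in> part L 0" "brk L h (phi L x1) \<in> part L 1"
      using brk_graded[of h 0 _ 0] brk_graded[of h 0 _ 1] h p by auto
    moreover have "scl L (\<alpha> h) (phi L (psi L x0)) \<in> part L 0"
      "scl L (\<alpha> h) (phi L (psi L x1)) \<in> part L 1"
      using p part_subspace by (simp_all add: subspace_scale)
    moreover have "brk L h (phi L x0) + brk L h (phi L x1) =
        scl L (\<alpha> h) (phi L (psi L x0)) + scl L (\<alpha> h) (phi L (psi L x1))"
      using root_spaceD[OF x h]
      by (simp add: x01 phi_add psi_add brk_add_right scale_right_distrib)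
    ultimately show ?thesis using part_unique by blast
  qed
  then have "x0 \<in> \<RR> \<alpha>" "x1 \<in> \<RR> \<alpha>" by (simp_all add: root_space_def)
  with x01 show "\<exists>x0\<in>\<RR> \<alpha> \<inter> part L 0. \<exists>x1\<in>\<RR> \<alpha> \<inter> part L 1. x = x0 + x1" by blast
qed

text \<open>The equation for phi(v) at h is the phi-image of the equation for v at phi^-1(h), and
  both h and phi^-1(h) run over the whole even part of H.\<close>

lemma phi_mem_root_space: "phi L v \<in> \<RR> (twist L \<alpha> (-1) 0) \<longleftrightarrow> v \<in> \<RR> \<alpha>"
proof -
  have *: "brk L h (phi L (phi L v)) = scl L (\<alpha> (inv (phi L) h)) (phi L (psi L (phi L v))) \<longleftrightarrow>
    brk L (inv (phi L) h) (phi L v) = scl L (\<alpha> (inv (phi L) h)) (phi L (psi L v))" for h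
  proof -
    have "brk L h (phi L (phi L v)) = phi L (brk L (inv (phi L) h) (phi L v))"
      by (simp add: phi_brk)
    moreover have "scl L c (phi L (psi L (phi L v))) = phi L (scl L c (phi L (psi L v)))" for c
      by (simp add: phi_scale phi_psi)
    ultimately show ?thesis by simp
  qed
  have "(\<forall>h\<in>even_part L H. P (inv (phi L) h)) \<longleftrightarrow> (\<forall>h\<in>even_part L H. P h)" for P
  proof (intro iffI ballI)
    fix h assume "\<forall>h\<in>even_part L H. P (inv (phi L) h)" "h \<in> even_part L H"
    then have "P (inv (phi L) (phi L h))" by (simp only: even_H_step)
    then show "P h" by simp
  qed (simp only: even_H_step)
  from this[of "\<lambda>h. brk L h (phi L v) = scl L (\<alpha> h) (phi L (psi L v))"] show ?thesis
    unfolding root_space_def mem_Collect_eq twist_def by (simp only: * comp_apply int_iter_0 int_iter_minus1 id_apply)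
qed

lemma psi_mem_root_space: "psi L v \<in> \<RR> (twist L \<alpha> 0 (-1)) \<longleftrightarrow> v \<in> \<RR> \<alpha>"
proof -
  have *: "brk L h (phi L (psi L v)) = scl L (\<alpha> (inv (psi L) h)) (phi L (psi L (psi L v))) \<longleftrightarrow>
    brk L (inv (psi L) h) (phi L v) = scl L (\<alpha> (inv (psi L) h)) (phi L (psi L v))" for h
  proof -
    have "brk L h (phi L (psi L v)) = psi L (brk L (inv (psi L) h) (phi L v))"
      by (simp add: psi_brk phi_psi)
    moreover have "scl L c (phi L (psi L (psi L v))) = psi L (scl L c (phi L (psi L v)))" for c
      by (simp add: psi_scale phi_psi)
    ultimately show ?thesis by simp
  qed
  have "(\<forall>h\<in>even_part L H. P (inv (psi L) h)) \<longleftrightarrow> (\<forall>h\<in>even_part L H. P h)" for P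
  proof (intro iffI ballI)
    fix h assume "\<forall>h\<in>even_part L H. P (inv (psi L) h)" "h \<in> even_part L H"
    then have "P (inv (psi L) (psi L h))" by (simp only: even_H_step)
    then show "P h" by simp
  qed (simp only: even_H_step)
  from this[of "\<lambda>h. brk L h (phi L v) = scl L (\<alpha> h) (phi L (psi L v))"] show ?thesis
    unfolding root_space_def mem_Collect_eq twist_def by (simp only: * comp_apply int_iter_0 int_iter_minus1 id_apply)
qed

lemma phi_root_space: "phi L ` \<RR> \<alpha> = \<RR> (twist L \<alpha> (-1) 0)"
proof (intro equalityI subsetI)
  fix x assume "x \<in> \<RR> (twist L \<alpha> (-1) 0)"
  then have "inv (phi L) x \<in> \<RR> \<alpha>" using phi_mem_root_space[of "inv (phi L) x" \<alpha>] by simp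
  then show "x \<in> phi L ` \<RR> \<alpha>" by (metis image_eqI phi_inv(1))
qed (auto simp: phi_mem_root_space)

lemma psi_root_space: "psi L ` \<RR> \<alpha> = \<RR> (twist L \<alpha> 0 (-1))"
proof (intro equalityI subsetI)
  fix x assume "x \<in> \<RR> (twist L \<alpha> 0 (-1))"
  then have "inv (psi L) x \<in> \<RR> \<alpha>" using psi_mem_root_space[of "inv (psi L) x" \<alpha>] by simp
  then show "x \<in> psi L ` \<RR> \<alpha>" by (metis image_eqI psi_inv(1))
qed (auto simp: psi_mem_root_space)

lemma phi_root_space': "phi L ` \<RR> (twist L \<alpha> 1 0) = \<RR> \<alpha>"
  and psi_root_space': "psi L ` \<RR> (twist L \<alpha> 0 1) = \<RR> \<alpha>"
  by (simp_all add: phi_root_space psi_root_space)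

lemma image_eq_zero_iff:
  assumes "inj f" "f 0 = 0" shows "f ` A = {0} \<longleftrightarrow> A = {0}"
  using inj_image_eq_iff[OF assms(1), of A "{0}"] assms(2) by simp

text \<open>The maps phi and psi realise only the exponent -1; two-sided integer induction reaches
  all twists. This is what makes the root system stable under twists.\<close>

lemma root_space_twist_trivial_iff: "\<RR> (twist L \<alpha> z w) = {0} \<longleftrightarrow> \<RR> \<alpha> = {0}"
proof -
  have phi: "\<RR> (twist L \<alpha> (-1) 0) = {0} \<longleftrightarrow> \<RR> \<alpha> = {0}" for \<alpha>
    unfolding phi_root_space[symmetric] by (rule image_eq_zero_iff[OF bij_is_inj[OF phi_bij] phi_zero])
  have psi: "\<RR> (twist L \<alpha> 0 (-1)) = {0} \<longleftrightarrow> \<RR> \<alpha> = {0}" for \<alpha>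
    unfolding psi_root_space[symmetric] by (rule image_eq_zero_iff[OF bij_is_inj[OF psi_bij] psi_zero])
  have z: "\<RR> (twist L \<alpha> z 0) = {0} \<longleftrightarrow> \<RR> \<alpha> = {0}" for z \<alpha>
  proof (induction z rule: int_induct[where k = 0])
    case (step1 i)
    then show ?case using phi[of "twist L \<alpha> (i + 1) 0"] by simp
  next
    case (step2 i)
    then show ?case using phi[of "twist L \<alpha> i 0"] by simp
  qed simp
  have w: "\<RR> (twist L \<alpha> 0 w) = {0} \<longleftrightarrow> \<RR> \<alpha> = {0}" for w \<alpha>
  proof (induction w rule: int_induct[where k = 0])
    case (step1 i)
    then show ?case using psi[of "twist L \<alpha> 0 (i + 1)"] by simp
  next
    case (step2 i)
    then show ?case using psi[of "twist L \<alpha> 0 i"] by simp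
  qed simp
  show ?thesis using w[of "twist L \<alpha> z 0" w] z by simp
qed

lemma twist_roots_iff [simp]: "twist L \<alpha> z w \<in> \<Lambda> \<longleftrightarrow> \<alpha> \<in> \<Lambda>"
proof
  show *: "twist L \<alpha> z w \<in> \<Lambda>" if "\<alpha> \<in> \<Lambda>" for \<alpha> z w
    using that by (simp add: roots_def root_space_twist_trivial_iff)
  assume "twist L \<alpha> z w \<in> \<Lambda>"
  from *[OF this, of "-z" "-w"] show "\<alpha> \<in> \<Lambda>" by simp
qed

lemma pm_roots_iff: "\<alpha> \<in> pm\<Lambda> \<longleftrightarrow> \<alpha> \<in> \<Lambda> \<or> - \<alpha> \<in> \<Lambda>"
  unfolding pm_roots_def by (metis UnCI UnE image_iff minus_minus)

lemma twist_pm_roots_iff [simp]: "twist L \<alpha> z w \<in> pm\<Lambda> \<longleftrightarrow> \<alpha> \<in> pm\<Lambda>"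
  by (simp add: pm_roots_iff flip: twist_uminus)

lemma uminus_pm_roots_iff [simp]: "- \<alpha> \<in> pm\<Lambda> \<longleftrightarrow> \<alpha> \<in> pm\<Lambda>"
  by (auto simp add: pm_roots_iff)

lemma pm_roots_dual: "\<alpha> \<in> pm\<Lambda> \<Longrightarrow> \<alpha> \<in> dual"
  unfolding pm_roots_iff using dual_uminus[of "- \<alpha>"] roots_dual by (metis minus_minus)

lemma pm_roots_nonzero: "\<alpha> \<in> pm\<Lambda> \<Longrightarrow> \<alpha> \<noteq> 0"
  unfolding pm_roots_iff using roots_nonzero by (metis neg_0_equal_iff_equal)

text \<open>\<open>root_space\<close> accepts any function, whereas \<open>roots\<close> is cut out
  of the dual. Weights must therefore be known to be functionals, which the closure rules for
  \<open>dual\<close> supply.\<close>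

lemma root_space_nonroot: "\<alpha> \<in> dual \<Longrightarrow> \<alpha> \<noteq> 0 \<Longrightarrow> \<alpha> \<notin> \<Lambda> \<Longrightarrow> \<RR> \<alpha> = {0}"
  by (simp add: roots_def)

text \<open>Applying the Leibniz identity to \<open>\<phi>\<psi>(h') = h\<close> makes \<open>[h, -]\<close> act as a derivation.\<close>
lemma brk_root_space:
  assumes x: "x \<in> \<RR> \<alpha>" and y: "y \<in> \<RR> \<beta>"
  shows "brk L x y \<in> \<RR> (twist L \<alpha> (-1) 0 + twist L \<beta> 0 (-1))" (is "_ \<in> \<RR> ?\<gamma>")
  using root_space_graded x
proof (induction x rule: graded_subspace_induct)
  case (homogeneous i x)
  show ?case using root_space_graded y
  proof (induction y rule: graded_subspace_induct)
    case hom: (homogeneous j y)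
    have "brk L h (phi L (brk L x y)) = scl L (?\<gamma> h) (phi L (psi L (brk L x y)))"
      if h: "h \<in> even_part L H" for h
    proof -
      define h' where "h' = inv (psi L) (inv (phi L) h)"
      have h': "h' \<in> even_part L H" "h = phi L (psi L h')" "psi L h' = inv (phi L) h"
        "phi L h' = inv (psi L) h"
        using h even_H_step by (simp_all add: h'_def phi_psi) (metis phi_inv psi_inv phi_psi)
      have m: "psi L h' \<in> even_part L H" "phi L h' \<in> even_part L H" by (simp_all only: even_H_step h'(1))
      have "brk L h (phi L (brk L x y)) = brk L (phi L (psi L h')) (brk L (phi L x) (phi L y))"
        by (simp add: phi_brk h'(2))
      also have "\<dots> = brk L (brk L (psi L h') (phi L x)) (psi L (phi L y))
          + scl L (koszul_sign 0 i) (brk L (psi L (phi L x)) (brk L (phi L h') (phi L y)))"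
        by (rule leibniz[where k = j])
          (use h'(1) homogeneous(2) hom(2) phi_even in blast)+
      \<comment> \<open>The sign is 1 because h' is even. The eigenvalues \<alpha>(psi h') =
        \<alpha>(phi^-1 h) and \<beta>(phi h') = \<beta>(psi^-1 h) are the origin of the two twists
        in the weight of a product.\<close>
      also have "\<dots> = scl L (?\<gamma> h) (phi L (psi L (brk L x y)))"
        using root_spaceD[OF homogeneous(1) m(1)] root_spaceD[OF hom(1) m(2)]
        by (simp add: koszul_sign_def h'(3,4) twist_def brk_scale_left brk_scale_right phi_brk psi_brk
            phi_psi scale_left_distrib)
      finally show ?thesis .
    qed
    then show ?case unfolding root_space_def by blast
  next
    case (add y y')
    then show ?case by (simp add: brk_add_right subspace_add root_space_subspace)
  qed
next
  case (add x x')
  then show ?case by (simp add: brk_add_left subspace_add root_space_subspace)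
qed

text \<open>For each term \<alpha> take h with \<alpha>(h) nonzero. Applying [h, phi(-)] to u and
  cancelling the injective map phi psi gives a vanishing combination with coefficients \<beta>(h),
  and directness of the root sum kills its \<alpha>-term.\<close>

lemma root_sum_eigenvalue_zero:
  assumes "u \<in> root_sum L H \<Lambda>" "u \<in> \<RR> 0"
  shows "u = 0"
proof -
  obtain F v where F: "finite F" "F \<subseteq> \<Lambda>" and v: "\<And>\<alpha>. v \<alpha> \<in> \<RR> \<alpha>" and u: "u = (\<Sum>\<alpha>\<in>F. v \<alpha>)"
    using span_Union_finite_sum[of \<RR> u \<Lambda>] root_space_subspace assms(1)
    unfolding root_sum_def by blast
  have "v \<alpha> = 0" if \<alpha>: "\<alpha> \<in> F" for \<alpha>
  proof -
    have "\<alpha> \<in> \<Lambda>" using \<alpha> F by blast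
    then obtain h where "\<alpha> h \<noteq> 0" using roots_nonzero by (metis ext zero_fun_def)
    \<comment> \<open>A functional is 0 off the even part of H, so a nonzero value places h
      there.\<close>
    then have h: "h \<in> even_part L H" using roots_dual[OF \<open>\<alpha> \<in> \<Lambda>\<close>] unfolding dual_even_def by blast
    have sum: "f (\<Sum>\<alpha>\<in>G. w \<alpha>) = (\<Sum>\<alpha>\<in>G. f (w \<alpha>))"
      if "f 0 = 0" "\<And>x y. f (x + y) = f x + f y" for f :: "'v \<Rightarrow> 'v" and w and G :: "('v \<Rightarrow> 'k) set"
      by (induction G rule: infinite_finite_induct) (simp_all add: that)
    have "brk L h (phi L u) = (\<Sum>\<alpha>\<in>F. brk L h (phi L (v \<alpha>)))"
      unfolding u by (rule sum) (simp_all add: phi_add brk_add_right)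
    also have "\<dots> = (\<Sum>\<alpha>\<in>F. phi L (psi L (scl L (\<alpha> h) (v \<alpha>))))"
      using root_spaceD[OF v h] by (simp add: psi_scale phi_scale)
    also have "\<dots> = phi L (psi L (\<Sum>\<alpha>\<in>F. scl L (\<alpha> h) (v \<alpha>)))"
      by (rule sum[symmetric, where f = "\<lambda>x. phi L (psi L x)"]) (simp_all add: phi_add psi_add)
    finally have "phi L (psi L (\<Sum>\<alpha>\<in>F. scl L (\<alpha> h) (v \<alpha>))) = phi L (psi L 0)"
      using root_spaceD[OF assms(2) h] by simp
    then have "(\<Sum>\<alpha>\<in>F. scl L (\<alpha> h) (v \<alpha>)) = 0" by (simp only: phi_eq_iff psi_eq_iff)
    then have eq: "scl L (\<alpha> h) (v \<alpha>) = - (\<Sum>\<beta>\<in>F - {\<alpha>}. scl L (\<beta> h) (v \<beta>))"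
      using sum.remove[OF F(1) \<alpha>, of "\<lambda>\<alpha>. scl L (\<alpha> h) (v \<alpha>)"] by (simp add: eq_neg_iff_add_eq_0)
    have "scl L (\<alpha> h) (v \<alpha>) \<in> \<RR> \<alpha>" using v root_space_subspace by (simp add: subspace_scale)
    moreover have "scl L (\<alpha> h) (v \<alpha>) \<in> span (\<Union>\<beta>\<in>\<Lambda> - {\<alpha>}. \<RR> \<beta>)"
      unfolding eq
    proof (intro span_neg span_sum span_scale)
      fix \<beta> assume "\<beta> \<in> F - {\<alpha>}"
      then show "v \<beta> \<in> span (\<Union>\<beta>\<in>\<Lambda> - {\<alpha>}. \<RR> \<beta>)" using v F by (intro span_base) blast
    qed
    ultimately have "scl L (\<alpha> h) (v \<alpha>) = 0"
      using roots_direct \<open>\<alpha> \<in> \<Lambda>\<close> unfolding is_direct_sum_def by blast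
    then show ?thesis using \<open>\<alpha> h \<noteq> 0\<close> by simp
  qed
  then show ?thesis by (simp add: u)
qed

text \<open>The root-sum component of a weight-zero vector again has weight zero, because H does,
  and hence vanishes. Products of total weight zero thus land in H, and H can be treated as one more
  root space.\<close>

lemma root_space_0: "\<RR> 0 = H"
proof
  show "H \<subseteq> \<RR> 0"
    using brk_H_H phi_H unfolding root_space_def by auto
  show "\<RR> 0 \<subseteq> H"
  proof
    fix v assume v: "v \<in> \<RR> 0"
    obtain h u where hu: "h \<in> H" "u \<in> root_sum L H \<Lambda>" "v = h + u"
      using is_direct_sum2_decomp[OF H_roots_direct, of v] by auto
    have "h \<in> \<RR> 0" using hu(1) \<open>H \<subseteq> \<RR> 0\<close> by blast
    then have u0: "u \<in> \<RR> 0"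
      using v hu(3) subspace_diff[OF root_space_subspace, of v 0 h] by simp
    have "u = 0" using root_sum_eigenvalue_zero[OF hu(2) u0] .
    then show "v \<in> H" using hu by simp
  qed
qed

end

section \<open>Connection of roots\<close>

text \<open>Index 0 does not occur in the chain conditions; with it a chain becomes a path of
  partial sums that starts at \<open>a 1\<close>.\<close>

lemma chain_sum_0: "chain_sum L a 0 = a 1"
  by (simp add: chain_sum_def)

context split_regular_bihom_leibniz_superalgebra
begin

text \<open>Passing to the next index lowers every earlier exponent of phi by one, while the new
  summand enters with exponent 0. The explicit sum is thereby an iterated step.\<close>

lemma chain_sum_Suc:
  "chain_sum L a (Suc i) = twist L (chain_sum L a i) (-1) 0 + twist L (a (i + 2)) 0 (-1)"
proof -
  have "{2..Suc i + 1} = insert (i + 2) {2..i + 1}" by auto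
  then have "(\<Sum>j = 2..Suc i + 1. twist L (a j) (int j - 1 - int (Suc i)) (- 1)) =
      twist L (a (i + 2)) 0 (-1) + (\<Sum>j = 2..i + 1. twist L (a j) (int j - 1 - int (Suc i)) (- 1))"
    by (simp del: sum.cl_ivl_Suc)
  moreover have "(\<Sum>j = 2..i + 1. twist L (a j) (int j - 1 - int (Suc i)) (- 1)) =
      twist L (\<Sum>j = 2..i + 1. twist L (a j) (int j - 1 - int i) (- 1)) (-1) 0"
    by (simp add: twist_sum algebra_simps del: sum.cl_ivl_Suc plus_fun_apply)
  moreover have "twist L (a 1) (- int (Suc i)) 0 = twist L (twist L (a 1) (- int i) 0) (-1) 0"
    by (simp add: algebra_simps)
  ultimately show ?thesis unfolding chain_sum_def twist_plus by (simp only: add_ac)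
qed

section \<open>Links between roots: steps, twists and signs\<close>

definition root_step :: "(('v \<Rightarrow> 'k) \<times> ('v \<Rightarrow> 'k)) set" where
  "root_step = {(s, t). s \<in> pm\<Lambda> \<and> t \<in> pm\<Lambda> \<and>
     (\<exists>a\<in>pm\<Lambda>. t = twist L s (-1) 0 + twist L a 0 (-1))}"

definition root_orbit :: "(('v \<Rightarrow> 'k) \<times> ('v \<Rightarrow> 'k)) set" where
  "root_orbit = {(s, t). s \<in> pm\<Lambda> \<and> t \<in> pm\<Lambda> \<and>
     (\<exists>z w. t = twist L s z w \<or> t = - twist L s z w)}"

text \<open>Steps are the moves inside a chain, orbit moves the twists and signs allowed at its
  ends. Their free closure is transitive by construction, whereas chains carry end conditions with
  nonpositive exponents that obstruct direct composition.\<close>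

definition root_link :: "(('v \<Rightarrow> 'k) \<times> ('v \<Rightarrow> 'k)) set" where
  "root_link = (root_step \<union> root_orbit)\<^sup>*"

lemma root_stepI:
  "\<lbrakk>s \<in> pm\<Lambda>; t \<in> pm\<Lambda>; a \<in> pm\<Lambda>; t = twist L s (-1) 0 + twist L a 0 (-1)\<rbrakk> \<Longrightarrow> (s, t) \<in> root_step"
  unfolding root_step_def by blast

lemma root_step_twist: "(s, t) \<in> root_step \<Longrightarrow> (twist L s z w, twist L t z w) \<in> root_step"
  unfolding root_step_def mem_Collect_eq prod.case
proof (elim conjE bexE)
  fix a assume a: "s \<in> pm\<Lambda>" "t \<in> pm\<Lambda>" "a \<in> pm\<Lambda>" "t = twist L s (-1) 0 + twist L a 0 (-1)"
  have "twist L t z w = twist L (twist L s z w) (-1) 0 + twist L (twist L a z w) 0 (-1)"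
    unfolding a(4) twist_plus twist_twist by (simp only: add.commute)
  then show "twist L s z w \<in> pm\<Lambda> \<and> twist L t z w \<in> pm\<Lambda> \<and>
      (\<exists>a\<in>pm\<Lambda>. twist L t z w = twist L (twist L s z w) (-1) 0 + twist L a 0 (-1))"
    using a by (metis twist_pm_roots_iff)
qed

lemma root_step_uminus: "(s, t) \<in> root_step \<Longrightarrow> (- s, - t) \<in> root_step"
  unfolding root_step_def mem_Collect_eq prod.case
proof (elim conjE bexE)
  fix a assume a: "s \<in> pm\<Lambda>" "t \<in> pm\<Lambda>" "a \<in> pm\<Lambda>" "t = twist L s (-1) 0 + twist L a 0 (-1)"
  have "- t = twist L (- s) (-1) 0 + twist L (- a) 0 (-1)"
    unfolding a(4) twist_uminus by (simp only: minus_add_distrib)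
  then show "- s \<in> pm\<Lambda> \<and> - t \<in> pm\<Lambda> \<and>
      (\<exists>a\<in>pm\<Lambda>. - t = twist L (- s) (-1) 0 + twist L a 0 (-1))"
    using a by (metis uminus_pm_roots_iff)
qed

lemma root_orbitI:
  assumes "s \<in> pm\<Lambda>" shows "(s, twist L s z w) \<in> root_orbit" "(s, - twist L s z w) \<in> root_orbit"
  using assms unfolding root_orbit_def by auto

lemma sym_root_orbit: "sym root_orbit"
proof (rule symI)
  fix s t assume st: "(s, t) \<in> root_orbit"
  then obtain z w where "t = twist L s z w \<or> t = - twist L s z w" and t: "t \<in> pm\<Lambda>"
    unfolding root_orbit_def by blast
  then have "s = twist L t (- z) (- w) \<or> s = - twist L t (- z) (- w)"
    by (auto simp: twist_uminus)
  then show "(t, s) \<in> root_orbit" using root_orbitI[OF t] by metis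
qed

lemma root_link_step: "(s, t) \<in> root_step \<Longrightarrow> (s, t) \<in> root_link"
  and root_link_orbit: "(s, t) \<in> root_orbit \<Longrightarrow> (s, t) \<in> root_link"
  unfolding root_link_def by blast+

lemma root_link_trans: "(s, t) \<in> root_link \<Longrightarrow> (t, u) \<in> root_link \<Longrightarrow> (s, u) \<in> root_link"
  unfolding root_link_def by (rule rtrancl_trans)

text \<open>The terms a phi^-1 psi^-1 cancel. The new increment -a phi^-1 is admissible because
  \<open>pm\<Lambda>\<close> is closed under sign and twists.\<close>

lemma root_step_reverse: "(s, t) \<in> root_step \<Longrightarrow> (t, twist L s (-2) 0) \<in> root_step"
proof -
  assume st: "(s, t) \<in> root_step"
  then obtain a where a: "s \<in> pm\<Lambda>" "t \<in> pm\<Lambda>" "a \<in> pm\<Lambda>" "t = twist L s (-1) 0 + twist L a 0 (-1)"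
    unfolding root_step_def by blast
  have eq: "twist L s (-2) 0 = twist L t (-1) 0 + twist L (- twist L a (-1) 0) 0 (-1)"
    unfolding a(4) twist_plus twist_uminus twist_twist by simp
  show ?thesis by (rule root_stepI[OF a(2) _ _ eq]) (simp_all add: a(1,3))
qed

lemma sym_root_link: "sym root_link"
proof (rule symI)
  fix s t assume "(s, t) \<in> root_link"
  then show "(t, s) \<in> root_link"
    unfolding root_link_def
  proof (induction rule: rtrancl_induct)
    case (step t u)
    have "(u, t) \<in> root_link"
    proof (cases "(t, u) \<in> root_step")
      case True
      then have "t \<in> pm\<Lambda>" unfolding root_step_def by blast
      then have "(t, twist L t (-2) 0) \<in> root_orbit" by (rule root_orbitI)
      then have "(twist L t (-2) 0, t) \<in> root_link"
        using sym_root_orbit root_link_orbit by (metis symD)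
      then show ?thesis using root_step_reverse[OF True] root_link_step root_link_trans by blast
    next
      case False
      then show ?thesis using step(2) sym_root_orbit root_link_orbit by (metis UnE symD)
    qed
    then show ?case using step(3) unfolding root_link_def by (rule rtrancl_trans)
  qed simp
qed

text \<open>Orbit moves are pushed to the end: by equivariance, a step that follows a twist or sign
  change can be taken before it. What remains is a run of steps and one final orbit move.\<close>

lemma root_link_imp_steps:
  assumes "(s, t) \<in> root_link"
  shows "\<exists>z w. (s, twist L t z w) \<in> root_step\<^sup>* \<or> (s, - twist L t z w) \<in> root_step\<^sup>*"
  using assms unfolding root_link_def
proof (induction rule: rtrancl_induct)
  case base
  have "(s, twist L s 0 0) \<in> root_step\<^sup>*" by simp
  then show ?case by blast
next
  case (step t u)
  then obtain z w where zw: "(s, twist L t z w) \<in> root_step\<^sup>* \<or> (s, - twist L t z w) \<in> root_step\<^sup>*"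
    by blast
  from step(2) show ?case
  proof
    assume "(t, u) \<in> root_step"
    then have "(twist L t z w, twist L u z w) \<in> root_step" by (rule root_step_twist)
    then show ?thesis using zw root_step_uminus by (metis rtrancl.rtrancl_into_rtrancl)
  next
    assume "(t, u) \<in> root_orbit"
    then have "(u, t) \<in> root_orbit" using sym_root_orbit by (metis symD)
    then obtain z' w' where "t = twist L u z' w' \<or> t = - twist L u z' w'"
      unfolding root_orbit_def by blast
    then have "twist L t z w = twist L u (z' + z) (w' + w) \<or>
        twist L t z w = - twist L u (z' + z) (w' + w)"
      by (auto simp: twist_uminus)
    then show ?thesis using zw by (metis minus_minus)
  qed
qed

lemma root_steps_twist: "(s, t) \<in> root_step\<^sup>* \<Longrightarrow> (twist L s z w, twist L t z w) \<in> root_step\<^sup>*"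
  by (induction rule: rtrancl_induct) (auto intro: rtrancl.rtrancl_into_rtrancl root_step_twist)

text \<open>A path of n steps is a chain of length n + 1, with the starting point as first member
  and the increments as the later ones. Distinct end points force n > 0, as a chain has at least two
  members.\<close>

lemma root_steps_imp_chain:
  assumes "(s, t) \<in> root_step\<^sup>*" "s \<noteq> t"
  shows "\<exists>k a. k \<ge> 2 \<and> (\<forall>i\<in>{1..k}. a i \<in> pm\<Lambda>) \<and> a 1 = s \<and>
    (\<forall>i\<in>{1..k - 2}. chain_sum L a i \<in> pm\<Lambda>) \<and> chain_sum L a (k - 1) = t"
proof -
  obtain n f where f: "f 0 = s" "f n = t" "\<And>i. i < n \<Longrightarrow> (f i, f (Suc i)) \<in> root_step"
    using assms(1) unfolding rtrancl_power relpow_fun_conv by blast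
  have n: "n > 0" using f assms(2) by (metis gr0I)
  have "\<forall>i. \<exists>b. i < n \<longrightarrow> b \<in> pm\<Lambda> \<and> f (Suc i) = twist L (f i) (-1) 0 + twist L b 0 (-1)"
    using f(3) unfolding root_step_def by blast
  then obtain b where b: "\<And>i. i < n \<Longrightarrow>
      b i \<in> pm\<Lambda> \<and> f (Suc i) = twist L (f i) (-1) 0 + twist L (b i) 0 (-1)"
    by metis
  \<comment> \<open>Increments are numbered from 0 and chain members from 1, so member j + 2 is
    \<open>b j\<close>; the value at 0 is arbitrary.\<close>
  define a where "a i = (if i \<le> 1 then s else b (i - 2))" for i
  have pm: "f i \<in> pm\<Lambda>" if "i < n" for i using f(3)[OF that] unfolding root_step_def by blast
  have chain: "i \<le> n \<Longrightarrow> chain_sum L a i = f i" for i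
  proof (induction i)
    case 0
    show ?case using f(1) by (simp add: chain_sum_0 a_def)
  next
    case (Suc i)
    then show ?case using b[of i] by (simp add: chain_sum_Suc a_def)
  qed
  have "a i \<in> pm\<Lambda>" if "i \<in> {1..Suc n}" for i
    using that b[of "i - 2"] pm[OF n] f(1) by (auto simp: a_def)
  moreover have "chain_sum L a i \<in> pm\<Lambda>" if "i \<in> {1..Suc n - 2}" for i
  proof -
    have "i < n" using that n by auto
    then show ?thesis using chain[of i] pm[of i] by simp
  qed
  ultimately show ?thesis
    using n f chain[of n] by (intro exI[of _ "Suc n"] exI[of _ a]) (simp add: a_def)
qed

text \<open>The partial sums form a path from \<open>a 1\<close> to a signed twist of \<beta>, with
  the further chain members as increments; the two end conditions are orbit moves.\<close>

lemma root_chain_imp_link: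
  assumes "root_chain L H \<alpha> \<beta> k a" "\<alpha> \<in> \<Lambda>" "\<beta> \<in> \<Lambda>"
  shows "(\<alpha>, \<beta>) \<in> root_link"
proof -
  have ab: "\<alpha> \<in> pm\<Lambda>" "\<beta> \<in> pm\<Lambda>" using assms(2,3) by (simp_all add: pm_roots_iff)
  have k: "k \<ge> 2" and a: "\<And>i. i \<in> {1..k} \<Longrightarrow> a i \<in> pm\<Lambda>"
    and mid: "\<And>i. i \<in> {1..k - 2} \<Longrightarrow> chain_sum L a i \<in> pm\<Lambda>"
    using assms(1) unfolding root_chain_def by blast+
  obtain n r where a1: "a 1 = twist L \<alpha> (- int n) (- int r)"
    using assms(1) unfolding root_chain_def by blast
  obtain m s where last: "chain_sum L a (k - 1) = twist L \<beta> (- int m) (- int s) \<or>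
      chain_sum L a (k - 1) = - twist L \<beta> (- int m) (- int s)"
    using assms(1) unfolding root_chain_def by blast
  \<comment> \<open>Only the middle sums are in \<open>pm\<Lambda>\<close> by the chain condition on
    partial sums. Index 0 is the member \<open>a 1\<close>, and the last sum is a signed twist of
    the root \<beta>.\<close>
  have pm: "chain_sum L a i \<in> pm\<Lambda>" if i: "i \<le> k - 1" for i
  proof -
    consider "i = 0" | "i \<in> {1..k - 2}" | "i = k - 1"
      using i k unfolding atLeastAtMost_iff by linarith
    then show ?thesis
    proof cases
      case 1
      then show ?thesis using a[of 1] k by (simp add: chain_sum_0)
    next
      case 2
      then show ?thesis by (rule mid)
    next
      case 3
      then show ?thesis using last ab by auto
    qed
  qed
  have "(\<alpha>, chain_sum L a i) \<in> root_link" if "i \<le> k - 1" for i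
    using that
  proof (induction i)
    case 0
    show ?case unfolding chain_sum_0 a1 by (intro root_link_orbit root_orbitI ab)
  next
    case (Suc i)
    have "(chain_sum L a i, chain_sum L a (Suc i)) \<in> root_step"
      using pm[of i] pm[of "Suc i"] a[of "i + 2"] Suc(2)
      by (intro root_stepI[where a = "a (i + 2)"] chain_sum_Suc) auto
    then show ?case using Suc root_link_step root_link_trans by (meson Suc_leD)
  qed
  then have "(\<alpha>, chain_sum L a (k - 1)) \<in> root_link" by blast
  moreover have "(\<beta>, chain_sum L a (k - 1)) \<in> root_link"
    using last root_orbitI[OF ab(2)] root_link_orbit by metis
  ultimately show ?thesis using sym_root_link root_link_trans by (metis symD)
qed

text \<open>
  Steps are equivariant under twists, so twisting a whole chain by \<open>\<phi>\<^sup>-\<^sup>N \<psi>\<^sup>-\<^sup>N\<close> with \<open>N\<close> large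
  makes the exponents at both ends nonpositive.
\<close>
lemma connection_iff_root_link:
  assumes "\<alpha> \<in> \<Lambda>" "\<beta> \<in> \<Lambda>"
  shows "(\<alpha>, \<beta>) \<in> connection L H \<longleftrightarrow> (\<alpha>, \<beta>) \<in> root_link"
proof
  have ab: "\<alpha> \<in> pm\<Lambda>" "\<beta> \<in> pm\<Lambda>" using assms by (simp_all add: pm_roots_iff)
  {
    assume "(\<alpha>, \<beta>) \<in> connection L H"
    then show "(\<alpha>, \<beta>) \<in> root_link"
      unfolding connection_def connected_roots_def
      using root_orbitI[OF ab(1)] root_link_orbit root_chain_imp_link by blast
  next
    assume link: "(\<alpha>, \<beta>) \<in> root_link"
    show "(\<alpha>, \<beta>) \<in> connection L H"
    \<comment> \<open>Roots in one orbit are connected by the first clause; setting them aside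
      guarantees the distinct end points needed to build a chain.\<close>
    proof (cases "(\<alpha>, \<beta>) \<in> root_orbit")
      case True
      then show ?thesis
        using assms unfolding connection_def connected_roots_def root_orbit_def by blast
    next
      case False
      obtain z w t where t: "t = twist L \<beta> z w \<or> t = - twist L \<beta> z w" "(\<alpha>, t) \<in> root_step\<^sup>*"
        using root_link_imp_steps[OF link] by blast
      define N where "N = nat (\<bar>z\<bar> + \<bar>w\<bar>)"
      define m where "m = nat (int N - z)"
      define s where "s = nat (int N - w)"
      have ms: "z - int N = - int m" "w - int N = - int s" unfolding m_def s_def N_def by arith+
      have ne: "\<alpha> \<noteq> t"
      proof
        assume "\<alpha> = t"
        then have "(\<beta>, \<alpha>) \<in> root_orbit" using t(1) root_orbitI[OF ab(2)] by metis
        then show False using False sym_root_orbit by (metis symD)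
      qed
      have "(twist L \<alpha> (- int N) (- int N), twist L t (- int N) (- int N)) \<in> root_step\<^sup>*"
        by (rule root_steps_twist[OF t(2)])
      moreover have "twist L \<alpha> (- int N) (- int N) \<noteq> twist L t (- int N) (- int N)"
        using ne by simp
      ultimately obtain k a where ka: "k \<ge> 2" "\<forall>i\<in>{1..k}. a i \<in> pm\<Lambda>"
        "a 1 = twist L \<alpha> (- int N) (- int N)" "\<forall>i\<in>{1..k - 2}. chain_sum L a i \<in> pm\<Lambda>"
        "chain_sum L a (k - 1) = twist L t (- int N) (- int N)"
        using root_steps_imp_chain by blast
      have "twist L t (- int N) (- int N) = twist L \<beta> (- int m) (- int s) \<or>
          twist L t (- int N) (- int N) = - twist L \<beta> (- int m) (- int s)"
        using t(1) ms by (auto simp: twist_uminus)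
      then have "root_chain L H \<alpha> \<beta> k a"
        unfolding root_chain_def ka(5) using ka(1-4) by blast
      then show ?thesis using assms unfolding connection_def connected_roots_def by blast
    qed
  }
qed

lemma connection_roots: "(\<alpha>, \<beta>) \<in> connection L H \<Longrightarrow> \<alpha> \<in> \<Lambda> \<and> \<beta> \<in> \<Lambda>"
  unfolding connection_def by blast

lemma equiv_connection: "equiv \<Lambda> (connection L H)"
proof (rule equivI)
  show "connection L H \<subseteq> \<Lambda> \<times> \<Lambda>" unfolding connection_def by blast
  show "refl_on \<Lambda> (connection L H)"
    using connection_iff_root_link unfolding refl_on_def root_link_def by blast
  show "sym (connection L H)"
    using connection_iff_root_link connection_roots sym_root_link by (metis symD symI)
  show "trans (connection L H)"
    using connection_iff_root_link connection_roots root_link_trans by (metis transI)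
qed

lemma root_classes_subset: "C \<in> root_classes L H \<Longrightarrow> C \<subseteq> \<Lambda>"
  unfolding root_classes_def using equiv_connection by (rule in_quotient_imp_subset)

text \<open>Membership in a class becomes a link to any one of its members, so the arguments about
  products never return to chains.\<close>

lemma root_classes_link:
  assumes "C \<in> root_classes L H" "\<alpha> \<in> C" "\<beta> \<in> \<Lambda>"
  shows "(\<alpha>, \<beta>) \<in> root_link \<longleftrightarrow> \<beta> \<in> C"
proof -
  have "\<alpha> \<in> \<Lambda>" using assms root_classes_subset by blast
  then show ?thesis
    using assms connection_iff_root_link[of \<alpha> \<beta>] equiv_connection
      in_quotient_imp_in_rel in_quotient_imp_closed
    unfolding root_classes_def by (metis empty_subsetI insert_subset)
qed

end

section \<open>The ideals of the decomposition\<close>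

context bihom_leibniz_superalgebra
begin

text \<open>A basis of S is extended to a basis of H, and the added vectors span the
  complement.\<close>

lemma subspace_complement_exists:
  assumes "subspace S" "subspace H" "S \<subseteq> H"
  shows "\<exists>U. linear_complement L H S U"
proof -
  obtain B where B: "B \<subseteq> S" "independent B" "S \<subseteq> span B"
    using maximal_independent_subset[of S] by blast
  obtain B' where B': "B \<subseteq> B'" "B' \<subseteq> H" "independent B'" "H \<subseteq> span B'"
    using maximal_independent_subset_extend[of B H] B assms(3) by blast
  have S: "S = span B" using B assms(1) by (simp add: span_minimal subset_antisym)
  have H: "H = span B'" using B' assms(2) by (simp add: span_minimal subset_antisym)
  have "H = span (B' - B) + S"
  proof -
    have "H = span ((B' - B) \<union> B)" using B'(1) H by (simp add: Un_absorb2)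
    then show ?thesis unfolding span_Un S set_plus_def by blast
  qed
  moreover have "span (B' - B) \<inter> S = {0}"
  proof -
    have "x = 0" if x: "x \<in> span (B' - B)" "x \<in> span B" for x
    proof -
      \<comment> \<open>The coordinates of x with respect to \<open>B'\<close> are supported both in
        \<open>B' - B\<close> and in \<open>B\<close>, hence all vanish.\<close>
      have "representation B' x = representation (B' - B) x" "representation B' x = representation B x"
        using B'(1,3) x by (auto intro: representation_extend)
      then have "representation B' x b = 0" for b
        using representation_ne_zero[of "B' - B" x b] representation_ne_zero[of B x b] by auto
      then show ?thesis
        using sum_nonzero_representation_eq[OF B'(3), of x] x(2) span_mono[OF B'(1)] by auto
    qed
    then show ?thesis unfolding S using span_zero by blast
  qed
  ultimately show ?thesis
    unfolding linear_complement_def is_direct_sum2_def by (intro exI[of _ "span (B' - B)"]) simp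
qed

end

context split_regular_bihom_leibniz_superalgebra
begin

section \<open>Products of root spaces and linked roots\<close>

text \<open>
  If \<open>\<gamma> = \<alpha>\<phi>\<^sup>-\<^sup>1 + \<beta>\<psi>\<^sup>-\<^sup>1\<close> is a root, adding \<open>-\<alpha>\<phi>\<^sup>-\<^sup>2\<psi>\<close> in a further step cancels \<open>\<alpha>\<close> and leaves
  \<open>\<beta>\<phi>\<^sup>-\<^sup>1\<psi>\<^sup>-\<^sup>1\<close>.
\<close>
lemma brk_root_link:
  assumes ab: "\<alpha> \<in> \<Lambda>" "\<beta> \<in> \<Lambda>" and xy: "x \<in> \<RR> \<alpha>" "y \<in> \<RR> \<beta>" and ne: "brk L x y \<noteq> 0"
  defines "\<gamma> \<equiv> twist L \<alpha> (-1) 0 + twist L \<beta> 0 (-1)"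
  shows "(\<alpha>, \<beta>) \<in> root_link" and "\<gamma> \<noteq> 0 \<Longrightarrow> \<gamma> \<in> \<Lambda> \<and> (\<alpha>, \<gamma>) \<in> root_link"
proof -
  have pm: "\<alpha> \<in> pm\<Lambda>" "\<beta> \<in> pm\<Lambda>" using ab by (simp_all add: pm_roots_iff)
  have brk: "brk L x y \<in> \<RR> \<gamma>" unfolding \<gamma>_def by (rule brk_root_space[OF xy])
  have dual: "\<gamma> \<in> dual" unfolding \<gamma>_def by (intro dual_add dual_twist roots_dual ab)
  have root: "\<gamma> \<in> \<Lambda>" if "\<gamma> \<noteq> 0" using root_space_nonroot[OF dual that] brk ne by blast
  have step: "(\<alpha>, \<gamma>) \<in> root_step" if "\<gamma> \<noteq> 0"
    using pm root[OF that] by (intro root_stepI[where a = \<beta>]) (auto simp: pm_roots_iff \<gamma>_def)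
  then show "\<gamma> \<noteq> 0 \<Longrightarrow> \<gamma> \<in> \<Lambda> \<and> (\<alpha>, \<gamma>) \<in> root_link"
    using root root_link_step by blast
  show "(\<alpha>, \<beta>) \<in> root_link"
  proof (cases "\<gamma> = 0")
    case True
    then have "twist L \<beta> 0 (-1) = - twist L \<alpha> (-1) 0"
      unfolding \<gamma>_def by (simp add: add_eq_0_iff)
    \<comment> \<open>Composing with psi solves the cancellation for \<beta>, which exhibits it as a
      signed twist of \<alpha>.\<close>
    then have "twist L (twist L \<beta> 0 (-1)) 0 1 = twist L (- twist L \<alpha> (-1) 0) 0 1" by simp
    then have "\<beta> = - twist L \<alpha> (-1) 1" unfolding twist_uminus twist_twist by simp
    then show ?thesis using root_orbitI(2)[OF pm(1)] root_link_orbit by metis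
  next
    case False
    have eq: "twist L \<beta> (-1) (-1) = twist L \<gamma> (-1) 0 + twist L (- twist L \<alpha> (-2) 1) 0 (-1)"
      unfolding \<gamma>_def twist_plus twist_uminus twist_twist by simp
    have "\<gamma> \<in> pm\<Lambda>" using root[OF False] by (simp add: pm_roots_iff)
    then have "(\<gamma>, twist L \<beta> (-1) (-1)) \<in> root_step"
      by (rule root_stepI[OF _ _ _ eq]) (simp_all add: pm)
    then have "(\<alpha>, twist L \<beta> (-1) (-1)) \<in> root_link"
      using step[OF False] root_link_step root_link_trans by blast
    moreover have "(twist L \<beta> (-1) (-1), \<beta>) \<in> root_link"
      using root_orbitI(1)[OF pm(2)] root_link_orbit sym_root_link by (metis symD)
    ultimately show ?thesis by (rule root_link_trans)
  qed
qed

text \<open>Signed twists such as -\<alpha> phi^-1 occur as weights of the generators in H and may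
  not be roots. Then the root space is zero; otherwise a nonzero product would link \<delta> with
  \<eta>, and hence \<alpha> with \<beta>.\<close>

lemma brk_orbits_unlinked:
  assumes link: "(\<alpha>, \<beta>) \<notin> root_link" and orb: "(\<alpha>, \<delta>) \<in> root_orbit" "(\<beta>, \<eta>) \<in> root_orbit"
    and xy: "x \<in> \<RR> \<delta>" "y \<in> \<RR> \<eta>"
  shows "brk L x y = 0" "brk L y x = 0"
proof -
  have pm: "\<delta> \<in> pm\<Lambda>" "\<eta> \<in> pm\<Lambda>" using orb unfolding root_orbit_def by blast+
  have nolink: "(\<delta>, \<eta>) \<notin> root_link" "(\<eta>, \<delta>) \<notin> root_link"
    using link orb root_link_orbit root_link_trans sym_root_link by (metis symD)+
  have x0: "x = 0" if "\<delta> \<notin> \<Lambda>"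
    using root_space_nonroot[of \<delta>] pm_roots_dual pm_roots_nonzero pm(1) xy(1) that by blast
  have y0: "y = 0" if "\<eta> \<notin> \<Lambda>"
    using root_space_nonroot[of \<eta>] pm_roots_dual pm_roots_nonzero pm(2) xy(2) that by blast
  show "brk L x y = 0"
    using brk_root_link(1)[OF _ _ xy] nolink x0 y0 brk_zero_left brk_zero_right by metis
  show "brk L y x = 0"
    using brk_root_link(1)[OF _ _ xy(2,1)] nolink x0 y0 brk_zero_left brk_zero_right by metis
qed

lemma cartan_gen_mem_H:
  assumes "x \<in> \<RR> (twist L \<beta> 0 (-1))" "y \<in> \<RR> (- twist L \<beta> (-1) 0)"
  shows "brk L x y \<in> H"
  using brk_root_space[OF assms] unfolding twist_uminus twist_twist by (simp add: root_space_0)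

text \<open>\<open>P\<close> will be the vanishing of an expression additive in each argument.
  Splitting all three arguments leaves homogeneous cases, where \<open>leibniz\<close>
  applies.\<close>

lemma root_space_trilinear:
  assumes "x \<in> \<RR> \<alpha>" "y \<in> \<RR> \<beta>" "z \<in> \<RR> \<gamma>"
    and hom: "\<And>i j k x y z. \<lbrakk>x \<in> \<RR> \<alpha> \<inter> part L i; y \<in> \<RR> \<beta> \<inter> part L j; z \<in> \<RR> \<gamma> \<inter> part L k\<rbrakk> \<Longrightarrow> P x y z"
    and add: "\<And>x x' y z. P x y z \<Longrightarrow> P x' y z \<Longrightarrow> P (x + x') y z"
      "\<And>x y y' z. P x y z \<Longrightarrow> P x y' z \<Longrightarrow> P x (y + y') z"
      "\<And>x y z z'. P x y z \<Longrightarrow> P x y z' \<Longrightarrow> P x y (z + z')"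
  shows "P x y z"
proof -
  obtain x0 x1 where x: "x0 \<in> \<RR> \<alpha> \<inter> part L 0" "x1 \<in> \<RR> \<alpha> \<inter> part L 1" "x = x0 + x1"
    using graded_subspace_decomp[OF root_space_graded assms(1)] by blast
  obtain y0 y1 where y: "y0 \<in> \<RR> \<beta> \<inter> part L 0" "y1 \<in> \<RR> \<beta> \<inter> part L 1" "y = y0 + y1"
    using graded_subspace_decomp[OF root_space_graded assms(2)] by blast
  obtain z0 z1 where z: "z0 \<in> \<RR> \<gamma> \<inter> part L 0" "z1 \<in> \<RR> \<gamma> \<inter> part L 1" "z = z0 + z1"
    using graded_subspace_decomp[OF root_space_graded assms(3)] by blast
  show ?thesis unfolding x(3) y(3) z(3)
    by (intro add) (rule hom; fact x y z)+
qed

text \<open>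
  By the Leibniz identity, \<open>[[x, y], z]\<close> is a combination of iterated products whose inner factor
  pairs \<open>z\<close> with \<open>x\<close> or \<open>y\<close> and hence vanishes.
\<close>
lemma brk_cartan_gen_left_unlinked:
  assumes ab: "\<alpha> \<in> \<Lambda>" "\<beta> \<in> \<Lambda>" and link: "(\<alpha>, \<beta>) \<notin> root_link"
    and x: "x \<in> \<RR> (twist L \<alpha> 0 (-1))" and y: "y \<in> \<RR> (- twist L \<alpha> (-1) 0)" and z: "z \<in> \<RR> \<beta>"
  shows "brk L (brk L x y) z = 0"
proof -
  have pm: "\<alpha> \<in> pm\<Lambda>" "\<beta> \<in> pm\<Lambda>" using ab by (simp_all add: pm_roots_iff)
  note orb = root_orbitI[OF pm(1)] root_orbitI[OF pm(2)]
  \<comment> \<open>Preimages under psi bring the product into the shape [[psi(x'), y], psi(z')] of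
    the identity.\<close>
  obtain x' where x': "x' \<in> \<RR> \<alpha>" "x = psi L x'" using x psi_root_space[of \<alpha>] by blast
  obtain z' where z': "z' \<in> \<RR> (twist L \<beta> 0 1)" "z = psi L z'" using z psi_root_space'[of \<beta>] by blast
  have "brk L (brk L (psi L x') y) (psi L z') = 0"
    using x'(1) y z'(1)
  proof (rule root_space_trilinear)
    fix i j k x y z
    assume hom: "x \<in> \<RR> \<alpha> \<inter> part L i" "y \<in> \<RR> (- twist L \<alpha> (-1) 0) \<inter> part L j"
      "z \<in> \<RR> (twist L \<beta> 0 1) \<inter> part L k"
    have "phi L x \<in> \<RR> (twist L \<alpha> (-1) 0)" using hom(1) phi_mem_root_space by blast
    then have "brk L (phi L x) z = 0" "brk L y z = 0"
      using brk_orbits_unlinked(1)[OF link] orb hom by blast+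
    then show "brk L (brk L (psi L x) y) (psi L z) = 0"
      using leibniz[of x i y j z k] hom by simp
  qed (simp_all add: brk_add_left brk_add_right psi_add)
  then show ?thesis by (simp add: x'(2) z'(2))
qed

text \<open>Here z is written as phi psi(z'). The right side of the identity then contains the inner
  factors [psi(z'), x] and [phi(z'), y], which both pair signed twists of unlinked roots.\<close>

lemma brk_cartan_gen_right_unlinked:
  assumes ab: "\<alpha> \<in> \<Lambda>" "\<beta> \<in> \<Lambda>" and link: "(\<alpha>, \<beta>) \<notin> root_link"
    and x: "x \<in> \<RR> (twist L \<alpha> 0 (-1))" and y: "y \<in> \<RR> (- twist L \<alpha> (-1) 0)" and z: "z \<in> \<RR> \<beta>"
  shows "brk L z (brk L x y) = 0"
proof -
  have pm: "\<alpha> \<in> pm\<Lambda>" "\<beta> \<in> pm\<Lambda>" using ab by (simp_all add: pm_roots_iff)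
  note orb = root_orbitI[OF pm(1)] root_orbitI[OF pm(2)]
  obtain u where u: "u \<in> \<RR> (twist L \<beta> 1 0)" "z = phi L u" using z phi_root_space'[of \<beta>] by blast
  obtain z' where z': "z' \<in> \<RR> (twist L \<beta> 1 1)" "u = psi L z'"
    using u(1) psi_root_space'[of "twist L \<beta> 1 0"] by auto
  have "brk L (phi L (psi L z')) (brk L x y) = 0"
    using z'(1) x y
  proof (rule root_space_trilinear)
    fix i j k z x y
    assume hom: "z \<in> \<RR> (twist L \<beta> 1 1) \<inter> part L i" "x \<in> \<RR> (twist L \<alpha> 0 (-1)) \<inter> part L j"
      "y \<in> \<RR> (- twist L \<alpha> (-1) 0) \<inter> part L k"
    have "phi L z \<in> \<RR> (twist L \<beta> 0 1)" "psi L z \<in> \<RR> (twist L \<beta> 1 0)"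
      using hom(1) phi_mem_root_space[of z "twist L \<beta> 1 1"] psi_mem_root_space[of z "twist L \<beta> 1 1"]
      by simp_all
    then have "brk L (phi L z) y = 0" "brk L (psi L z) x = 0"
      using brk_orbits_unlinked(2)[OF link] orb hom by blast+
    then show "brk L (phi L (psi L z)) (brk L x y) = 0"
      using leibniz[of z i x j y k] hom by simp
  qed (simp_all add: brk_add_left brk_add_right psi_add phi_add)
  then show ?thesis by (simp add: u(2) z'(2))
qed

section \<open>Generators of the class ideals\<close>

definition cartan_gens :: "('v \<Rightarrow> 'k) set \<Rightarrow> 'v set" where
  "cartan_gens C = (\<Union>\<beta>\<in>C. {brk L x y |x y. x \<in> \<RR> (twist L \<beta> 0 (-1)) \<and> y \<in> \<RR> (- twist L \<beta> (-1) 0)})"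

definition class_gens :: "('v \<Rightarrow> 'k) set \<Rightarrow> 'v set" where
  "class_gens C = cartan_gens C \<union> (\<Union>\<beta>\<in>C. \<RR> \<beta>)"

text \<open>The nested spans collapse to one span of single products, the form required by
  \<open>brk_span_subset\<close>, \<open>phi_span\<close> and \<open>psi_span\<close>.\<close>

lemma cartan_span_eq: "cartan_span L H C = span (cartan_gens C)"
proof
  show "cartan_span L H C \<subseteq> span (cartan_gens C)"
    unfolding cartan_span_def brk_span_def cartan_gens_def
    by (intro span_minimal UN_least span_mono) auto
  show "span (cartan_gens C) \<subseteq> cartan_span L H C"
    unfolding cartan_span_def brk_span_def cartan_gens_def
    by (intro span_mono UN_mono span_superset) simp
qed

lemma class_ideal_eq: "class_ideal L H C = span (class_gens C)"
  unfolding class_ideal_def cartan_span_eq root_sum_def class_gens_def span_Un set_plus_def by blast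

lemma UNIV_eq_span: "UNIV = span (H \<union> (\<Union>\<beta>\<in>\<Lambda>. \<RR> \<beta>))"
proof -
  have "UNIV = H + root_sum L H \<Lambda>" using H_roots_direct by (simp add: is_direct_sum2_def)
  also have "\<dots> = span (H \<union> (\<Union>\<beta>\<in>\<Lambda>. \<RR> \<beta>))"
    unfolding span_Un root_sum_def set_plus_def span_eq_iff[THEN iffD2, OF H_subspace] by blast
  finally show ?thesis .
qed

lemma cartan_gens_H: "cartan_gens C \<subseteq> H"
  unfolding cartan_gens_def using cartan_gen_mem_H by blast

lemma cartan_span_H: "cartan_span L H C \<subseteq> H"
  unfolding cartan_span_eq by (rule span_minimal[OF cartan_gens_H H_subspace])

lemma root_classes_twist:
  assumes "C \<in> root_classes L H" "\<beta> \<in> C"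
  shows "twist L \<beta> z w \<in> C"
proof -
  have "\<beta> \<in> \<Lambda>" using assms root_classes_subset by blast
  moreover from this have "(\<beta>, twist L \<beta> z w) \<in> root_link"
    by (intro root_link_orbit root_orbitI) (simp add: pm_roots_iff)
  ultimately show ?thesis using root_classes_link[OF assms] by simp
qed

lemma root_classes_unlinked:
  assumes "C \<in> root_classes L H" "D \<in> root_classes L H" "C \<noteq> D" "\<alpha> \<in> C" "\<beta> \<in> D"
  shows "(\<alpha>, \<beta>) \<notin> root_link"
proof -
  have "\<beta> \<in> \<Lambda>" "\<beta> \<notin> C"
    using assms root_classes_subset quotient_disj[OF equiv_connection] unfolding root_classes_def
    by blast+
  then show ?thesis using root_classes_link assms by blast
qed

lemma class_gens_brk_unlinked:
  assumes "C \<in> root_classes L H" "D \<in> root_classes L H" "C \<noteq> D"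
    and a: "a \<in> class_gens C" and b: "b \<in> class_gens D"
  shows "brk L a b = 0"
proof -
  note unl = root_classes_unlinked[OF assms(1-3)] root_classes_unlinked[OF assms(2,1) assms(3)[symmetric]]
  have sub: "C \<subseteq> \<Lambda>" "D \<subseteq> \<Lambda>" using assms(1,2) root_classes_subset by blast+
  consider "a \<in> cartan_gens C" "b \<in> cartan_gens D"
    | \<beta> where "a \<in> cartan_gens C" "\<beta> \<in> D" "b \<in> \<RR> \<beta>"
    | \<alpha> where "\<alpha> \<in> C" "a \<in> \<RR> \<alpha>" "b \<in> cartan_gens D"
    | \<alpha> \<beta> where "\<alpha> \<in> C" "a \<in> \<RR> \<alpha>" "\<beta> \<in> D" "b \<in> \<RR> \<beta>"
    using a b unfolding class_gens_def by blast
  then show ?thesis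
  proof cases
    case 1
    then show ?thesis using cartan_gens_H brk_H_H by blast
  next
    case 2
    then obtain \<alpha> x y where "\<alpha> \<in> C" "a = brk L x y" "x \<in> \<RR> (twist L \<alpha> 0 (-1))"
      "y \<in> \<RR> (- twist L \<alpha> (-1) 0)" unfolding cartan_gens_def by blast
    moreover have "(\<alpha>, \<beta>) \<notin> root_link" using unl(1) 2 \<open>\<alpha> \<in> C\<close> by blast
    ultimately show ?thesis using brk_cartan_gen_left_unlinked[of \<alpha> \<beta> x y b] sub 2 by blast
  next
    case 3
    then obtain \<beta> x y where "\<beta> \<in> D" "b = brk L x y" "x \<in> \<RR> (twist L \<beta> 0 (-1))"
      "y \<in> \<RR> (- twist L \<beta> (-1) 0)" unfolding cartan_gens_def by blast
    moreover have "(\<beta>, \<alpha>) \<notin> root_link" using unl(2) 3 \<open>\<beta> \<in> D\<close> by blast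
    ultimately show ?thesis using brk_cartan_gen_right_unlinked[of \<beta> \<alpha> x y a] sub 3 by blast
  next
    case 4
    then show ?thesis using brk_root_link(1)[OF _ _ 4(2,4)] unl(1)[OF 4(1,3)] sub by blast
  qed
qed

text \<open>A nonzero product either has nonzero weight, which is a root linked to \<alpha> and so
  in \<open>C\<close>, or has weight zero and is itself one of the generators in H.\<close>

lemma brk_root_spaces_mem_class_ideal:
  assumes C: "C \<in> root_classes L H" and "\<alpha> \<in> C" "\<beta> \<in> \<Lambda>" and xy: "x \<in> \<RR> \<alpha>" "y \<in> \<RR> \<beta>"
  shows "brk L x y \<in> class_ideal L H C"
proof -
  let ?\<gamma> = "twist L \<alpha> (-1) 0 + twist L \<beta> 0 (-1)"
  have "\<alpha> \<in> \<Lambda>" using assms root_classes_subset by blast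
  consider "brk L x y = 0" | "brk L x y \<noteq> 0" "?\<gamma> \<noteq> 0" | "?\<gamma> = 0" by blast
  then show ?thesis
  proof cases
    case 1
    then show ?thesis unfolding class_ideal_eq by (simp add: span_zero)
  next
    case 2
    then have "?\<gamma> \<in> C"
      using brk_root_link(2)[OF \<open>\<alpha> \<in> \<Lambda>\<close> assms(3) xy] root_classes_link[OF C assms(2)] by blast
    then show ?thesis
      using brk_root_space[OF xy] unfolding class_ideal_eq class_gens_def by (intro span_base) blast
  next
    case 3
    then have "twist L \<beta> 0 (-1) = - twist L \<alpha> (-1) 0" by (simp add: add_eq_0_iff)
    then have "twist L (twist L \<beta> 0 (-1)) 0 1 = twist L (- twist L \<alpha> (-1) 0) 0 1" by simp
    \<comment> \<open>The class member that exhibits the product as a generator is \<alpha> psi: x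
      has weight (\<alpha> psi) psi^-1 and y has weight -(\<alpha> psi) phi^-1.\<close>
    then have \<beta>: "\<beta> = - twist L (twist L \<alpha> 0 1) (-1) 0" unfolding twist_uminus twist_twist by simp
    have "x \<in> \<RR> (twist L (twist L \<alpha> 0 1) 0 (-1))" "y \<in> \<RR> (- twist L (twist L \<alpha> 0 1) (-1) 0)"
      using xy unfolding \<beta> by simp_all
    then have "brk L x y \<in> cartan_gens C"
      unfolding cartan_gens_def using root_classes_twist[OF C assms(2), of 0 1] by blast
    then show ?thesis unfolding class_ideal_eq class_gens_def by (intro span_base) blast
  qed
qed

lemma class_gens_brk_mem:
  assumes C: "C \<in> root_classes L H" and a: "a \<in> class_gens C" and b: "b \<in> H \<union> (\<Union>\<beta>\<in>\<Lambda>. \<RR> \<beta>)"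
  shows "brk L a b \<in> class_ideal L H C \<and> brk L b a \<in> class_ideal L H C"
proof -
  have zero: "0 \<in> class_ideal L H C" unfolding class_ideal_eq by (rule span_zero)
  have mem: "v \<in> class_ideal L H C" if "\<beta> \<in> C" "v \<in> \<RR> \<beta>" for v \<beta>
    using that unfolding class_ideal_eq class_gens_def by (intro span_base) blast
  \<comment> \<open>As H is the root space of 0, bracketing with h only twists the weight, by phi^-1
    or psi^-1 according to the side, and \<open>C\<close> is closed under twists.\<close>
  have H: "brk L v h \<in> class_ideal L H C \<and> brk L h v \<in> class_ideal L H C"
    if "\<beta> \<in> C" "v \<in> \<RR> \<beta>" "h \<in> H" for v h \<beta>
    using brk_root_space[of v \<beta> h 0] brk_root_space[of h 0 v \<beta>] that root_space_0
      mem[OF root_classes_twist[OF C that(1)]] by simp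
  \<comment> \<open>For a generator in H against a root vector the class of \<beta> decides: inside
    \<open>C\<close> the generator acts merely as an element of H, outside \<open>C\<close> both
    products vanish.\<close>
  consider "a \<in> cartan_gens C" "b \<in> H"
    | \<beta> where "a \<in> cartan_gens C" "\<beta> \<in> C" "b \<in> \<RR> \<beta>"
    | \<beta> where "a \<in> cartan_gens C" "\<beta> \<in> \<Lambda>" "\<beta> \<notin> C" "b \<in> \<RR> \<beta>"
    | \<alpha> where "\<alpha> \<in> C" "a \<in> \<RR> \<alpha>" "b \<in> H"
    | \<alpha> \<beta> where "\<alpha> \<in> C" "a \<in> \<RR> \<alpha>" "\<beta> \<in> \<Lambda>" "b \<in> \<RR> \<beta>"
    using a b unfolding class_gens_def by blast
  then show ?thesis
  proof cases
    case 1
    then have "brk L a b = 0" "brk L b a = 0" using cartan_gens_H brk_H_H by blast+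
    then show ?thesis using zero by simp
  next
    case 2
    then show ?thesis using H cartan_gens_H by blast
  next
    case 3
    then obtain \<alpha> x y where \<alpha>: "\<alpha> \<in> C" "a = brk L x y" "x \<in> \<RR> (twist L \<alpha> 0 (-1))"
      "y \<in> \<RR> (- twist L \<alpha> (-1) 0)" unfolding cartan_gens_def by blast
    have "\<alpha> \<in> \<Lambda>" "(\<alpha>, \<beta>) \<notin> root_link"
      using \<alpha>(1) 3 C root_classes_subset root_classes_link by blast+
    then have "brk L a b = 0" "brk L b a = 0"
      using brk_cartan_gen_left_unlinked brk_cartan_gen_right_unlinked \<alpha>(2-4) 3 by blast+
    then show ?thesis using zero by simp
  next
    case 4
    then show ?thesis using H by blast
  next
    case 5
    \<comment> \<open>The left factor now belongs to \<beta>, which need not be in \<open>C\<close>.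
      If it is, the roles are exchanged; if not, \<beta> and \<alpha> are unlinked and the product
      is zero.\<close>
    have "brk L b a \<in> class_ideal L H C"
    proof (cases "\<beta> \<in> C")
      case True
      then show ?thesis
        using brk_root_spaces_mem_class_ideal[OF C True _ 5(4,2)] 5 C root_classes_subset by blast
    next
      case False
      then have "(\<beta>, \<alpha>) \<notin> root_link"
        using root_classes_link[OF C 5(1,3)] sym_root_link by (metis symD)
      then have "brk L b a = 0"
        using brk_root_link(1)[OF 5(3) _ 5(4,2)] 5(1) C root_classes_subset by blast
      then show ?thesis using zero by simp
    qed
    then show ?thesis using brk_root_spaces_mem_class_ideal[OF C 5(1,3,2,4)] by blast
  qed
qed

text \<open>Each automorphism carries the block of generators attached to \<beta> onto the block of
  a twist of \<beta>, and twisting permutes \<open>C\<close>.\<close>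

lemma image_class_gens:
  assumes "C \<in> root_classes L H"
  shows "phi L ` class_gens C = class_gens C" "psi L ` class_gens C = class_gens C"
proof -
  have brk_image: "f ` {brk L x y |x y. x \<in> A \<and> y \<in> B} = {brk L x y |x y. x \<in> f ` A \<and> y \<in> f ` B}"
    if hom: "\<And>x y. f (brk L x y) = brk L (f x) (f y)" for f A B
  proof (intro subset_antisym subsetI)
    fix v assume "v \<in> {brk L x y |x y. x \<in> f ` A \<and> y \<in> f ` B}"
    then obtain x y where "x \<in> A" "y \<in> B" "v = brk L (f x) (f y)" by blast
    then show "v \<in> f ` {brk L x y |x y. x \<in> A \<and> y \<in> B}" unfolding hom[symmetric] by blast
  qed (auto simp: hom, blast)
  define g where "g \<beta> = {brk L x y |x y. x \<in> \<RR> (twist L \<beta> 0 (-1)) \<and> y \<in> \<RR> (- twist L \<beta> (-1) 0)} \<union> \<RR> \<beta>" for \<beta>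
  have gens: "class_gens C = (\<Union>\<beta>\<in>C. g \<beta>)" unfolding class_gens_def cartan_gens_def g_def by blast
  have "phi L ` g \<beta> = g (twist L \<beta> (-1) 0)" "psi L ` g \<beta> = g (twist L \<beta> 0 (-1))" for \<beta>
    unfolding g_def image_Un brk_image[of "phi L", OF phi_brk] brk_image[of "psi L", OF psi_brk]
      phi_root_space psi_root_space twist_uminus twist_twist by simp_all
  then have im: "phi L ` class_gens C = (\<Union>\<beta>\<in>(\<lambda>\<beta>. twist L \<beta> (-1) 0) ` C. g \<beta>)"
    "psi L ` class_gens C = (\<Union>\<beta>\<in>(\<lambda>\<beta>. twist L \<beta> 0 (-1)) ` C. g \<beta>)"
    unfolding gens image_UN by simp_all
  have C: "(\<lambda>\<beta>. twist L \<beta> z w) ` C = C" for z w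
  proof
    show "C \<subseteq> (\<lambda>\<beta>. twist L \<beta> z w) ` C"
    proof
      fix \<beta> assume "\<beta> \<in> C"
      then have "twist L \<beta> (- z) (- w) \<in> C" by (rule root_classes_twist[OF assms])
      moreover have "\<beta> = twist L (twist L \<beta> (- z) (- w)) z w" by simp
      ultimately show "\<beta> \<in> (\<lambda>\<beta>. twist L \<beta> z w) ` C" by blast
    qed
  qed (use root_classes_twist[OF assms] in blast)
  show "phi L ` class_gens C = class_gens C" "psi L ` class_gens C = class_gens C"
    by (simp_all only: im C flip: gens)
qed

lemma class_ideal_ideal:
  assumes C: "C \<in> root_classes L H"
  shows "bihom_ideal L (class_ideal L H C)"
  unfolding bihom_ideal_def
proof (intro conjI)
  let ?I = "class_ideal L H C"
  have sub: "subspace ?I" unfolding class_ideal_eq by (rule subspace_span)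
  \<comment> \<open>Gradedness comes from the nested definition instead of the flat generating set,
    because \<open>graded_subspace_brk_span\<close> speaks about \<open>brk_span\<close>.\<close>
  show "graded_subspace L ?I"
    unfolding class_ideal_def cartan_span_def root_sum_def
    by (intro graded_subspace_plus graded_subspace_span_Union graded_subspace_brk_span
        root_space_graded)
  have "brk_span L ?I UNIV \<subseteq> ?I"
    unfolding UNIV_eq_span using class_gens_brk_mem[OF C]
    by (subst class_ideal_eq, intro brk_span_subset sub) blast
  moreover have "brk_span L UNIV ?I \<subseteq> ?I"
    unfolding UNIV_eq_span using class_gens_brk_mem[OF C]
    by (subst class_ideal_eq, intro brk_span_subset sub) blast
  ultimately show "brk_span L ?I UNIV + brk_span L UNIV ?I \<subseteq> ?I"
    using sub subspace_add by (blast elim!: set_plus_elim)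
  show "phi L ` ?I = ?I" "psi L ` ?I = ?I"
    unfolding class_ideal_eq phi_span psi_span by (simp_all add: image_class_gens[OF C])
qed

lemma class_ideals_brk:
  assumes "C \<in> root_classes L H" "D \<in> root_classes L H" "C \<noteq> D"
  shows "brk_span L (class_ideal L H C) (class_ideal L H D) = {0}"
proof
  show "brk_span L (class_ideal L H C) (class_ideal L H D) \<subseteq> {0}"
    unfolding class_ideal_eq using class_gens_brk_unlinked[OF assms]
    by (intro brk_span_subset) simp_all
qed (simp add: brk_span_def span_zero)

section \<open>Directness and the decomposition of the whole space\<close>

lemma class_direct_sum:
  assumes "C \<in> root_classes L H"
  shows "is_direct_sum L (root_sum L H C) \<RR> C"
  unfolding is_direct_sum_def
proof (intro conjI ballI)
  fix \<beta> assume \<beta>: "\<beta> \<in> C"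
  then have "span (\<Union>\<gamma>\<in>C - {\<beta>}. \<RR> \<gamma>) \<subseteq> span (\<Union>\<gamma>\<in>\<Lambda> - {\<beta>}. \<RR> \<gamma>)"
    using root_classes_subset[OF assms] by (intro span_mono) blast
  moreover have "\<RR> \<beta> \<inter> span (\<Union>\<gamma>\<in>\<Lambda> - {\<beta>}. \<RR> \<gamma>) = {0}"
    using roots_direct \<beta> root_classes_subset[OF assms] unfolding is_direct_sum_def by blast
  moreover have "0 \<in> \<RR> \<beta>" by (rule subspace_0[OF root_space_subspace])
  ultimately show "\<RR> \<beta> \<inter> span (\<Union>\<gamma>\<in>C - {\<beta>}. \<RR> \<gamma>) = {0}"
    using span_zero by blast
qed (simp add: root_sum_def)

lemma class_direct_sum2:
  assumes "C \<in> root_classes L H"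
  shows "is_direct_sum2 (class_ideal L H C) (cartan_span L H C) (root_sum L H C)"
  unfolding is_direct_sum2_def
proof
  have "root_sum L H C \<subseteq> root_sum L H \<Lambda>"
    unfolding root_sum_def using root_classes_subset[OF assms] by (intro span_mono) blast
  moreover have "H \<inter> root_sum L H \<Lambda> = {0}" using H_roots_direct by (simp add: is_direct_sum2_def)
  moreover have "0 \<in> cartan_span L H C" "0 \<in> root_sum L H C"
    unfolding cartan_span_eq root_sum_def by (simp_all add: span_zero)
  ultimately show "cartan_span L H C \<inter> root_sum L H C = {0}" using cartan_span_H by blast
qed (simp add: class_ideal_def)

text \<open>Every generator is attached to a single root, so the generators for all of
  \<open>\<Lambda>\<close> are distributed among the classes. \<open>U\<close> supplies the part of
  H that the products do not reach.\<close>

lemma decomposition: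
  assumes "linear_complement L H (cartan_span L H \<Lambda>) U"
  shows "UNIV = U + span (\<Union>C\<in>root_classes L H. class_ideal L H C)"
proof -
  let ?S = "span (\<Union>C\<in>root_classes L H. class_ideal L H C)"
  have cover: "\<exists>C\<in>root_classes L H. \<beta> \<in> C" if "\<beta> \<in> \<Lambda>" for \<beta>
    using that Union_quotient[OF equiv_connection] unfolding root_classes_def by blast
  have "class_gens \<Lambda> \<subseteq> ?S"
  proof
    fix x assume "x \<in> class_gens \<Lambda>"
    then obtain C where "C \<in> root_classes L H" "x \<in> class_gens C"
      using cover unfolding class_gens_def cartan_gens_def by blast
    then show "x \<in> ?S" unfolding class_ideal_eq by (intro span_base) (blast intro: span_base)
  qed
  then have gens: "span (class_gens \<Lambda>) \<subseteq> ?S" by (simp add: span_minimal)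
  have "x \<in> U + ?S" for x
  proof -
    obtain h r where h: "h \<in> H" "r \<in> root_sum L H \<Lambda>" "x = h + r"
      using is_direct_sum2_decomp[OF H_roots_direct, of x] by auto
    obtain u c where u: "u \<in> U" "c \<in> cartan_span L H \<Lambda>" "h = u + c"
      using is_direct_sum2_decomp[of H U _ h] assms h(1) unfolding linear_complement_def by blast
    have "c + r \<in> class_ideal L H \<Lambda>" unfolding class_ideal_def using u h by (intro set_plus_intro)
    then have "c + r \<in> ?S" using gens unfolding class_ideal_eq by blast
    then show ?thesis using u h by (simp add: add.assoc set_plus_intro)
  qed
  then show ?thesis by blast
qed

end

theorem theorem2p13:
  fixes L :: "('k::field, 'v::ab_group_add) bihom_superalg" and H :: "'v set"
  assumes "split_regular_bihom_leibniz_superalgebra L H"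
  shows "(\<exists>U. linear_complement L H (cartan_span L H (roots L H)) U)
    \<and> (\<forall>U. linear_complement L H (cartan_span L H (roots L H)) U \<longrightarrow>
          UNIV = U + lspan L (\<Union>C\<in>root_classes L H. class_ideal L H C))
    \<and> (\<forall>C\<in>root_classes L H.
          bihom_ideal L (class_ideal L H C)
          \<and> cartan_span L H C \<subseteq> H
          \<and> is_direct_sum L (root_sum L H C) (root_space L H) C
          \<and> is_direct_sum2 (class_ideal L H C) (cartan_span L H C) (root_sum L H C))
    \<and> (\<forall>C\<in>root_classes L H. \<forall>D\<in>root_classes L H.
          C \<noteq> D \<longrightarrow> brk_span L (class_ideal L H C) (class_ideal L H D) = {0})"
proof -
  interpret split_regular_bihom_leibniz_superalgebra L H by fact
  have "\<exists>U. linear_complement L H (cartan_span L H (roots L H)) U"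
    by (rule subspace_complement_exists[OF _ H_subspace cartan_span_H])
      (simp add: cartan_span_eq)
  then show ?thesis
    using decomposition class_ideal_ideal cartan_span_H class_direct_sum class_direct_sum2
      class_ideals_brk by simp
qed

end
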